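(* Let $X(t)$, $a\le t\le b$, be a Yeh process associated with functions $\lambda$ and $\rho$ on $[a,b]$, and let $\widetilde X(t)=X(t)-\lambda(t)$ be the centered Yeh process. Let $\{\phi_n\}_{n=1}^\infty$ be an orthonormal basis for $L^2_\rho[a,b]$. Then for each $f\in L^2_\rho[a,b]$, the Wiener integral of $f$ with respect to $\widetilde X(t)$ has the random series expansion $$\int_a^b f(t)\,d\widetilde X(t)=\sum_{n=1}^\infty\langle f,\phi_n\rangle_\rho\int_a^b\phi_n(t)\,d\widetilde X(t),$$ where the right-hand side converges in $L^2(\Omega)$ and almost surely.
   Context: Fix a finite interval $[a,b]\subset[0,\infty)$. Standing assumptions: $\lambda$ is a continuous real-valued function of bounded variation on $[a,b]$; $\rho$ is a continuous monotonically increasing real-valued function on $[a,b]$ whose Lebesgue-Stieltjes measure is equivalent (mutually absolutely continuous) to Lebesgue measure on $[a,b]$. A Yeh process associated with $\lambda,\rho$ is a real-valued stochastic process $X(t)$, $t\in[a,b]$, on a probability space $\Omega$, with (almost surely) continuous sample paths and independent increments such that for all $a\le s<t\le b$, $X(t)-X(s)\sim N(\lambda(t)-\lambda(s),\rho(t)-\rho(s))$, where $N(\mu,\sigma^2)$ is the normal distribution with mean $\mu$ and variance $\sigma^2$. Thus $\widetilde X$ is a Yeh process associated with the functions $0$ and $\rho$. $L^2_\rho[a,b]$ is the Hilbert space of real functions $f$ on $[a,b]$ with $\int_a^b|f|^2\,d\rho<\infty$, with inner product $\langle f,g\rangle_\rho=\int_a^b fg\,d\rho$. Wiener integral with respect to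 $\widetilde X$: for a step function $f=\sum_{i=1}^n c_i1_{[t_{i-1},t_i)}$ with $a=t_0<\dots<t_n=b$ and $c_i\in\mathbb R$, set $\widetilde I(f)=\sum_{i=1}^n c_i(\widetilde X(t_i)-\widetilde X(t_{i-1}))$. Step functions are dense in $L^2_\rho[a,b]$; for $f\in L^2_\rho[a,b]$, $\widetilde I(f)=\int_a^b f(t)\,d\widetilde X(t)$ is defined as the $L^2(\Omega)$-limit of $\widetilde I(f_n)$ for any sequence of step functions $f_n$ converging to $f$ in $L^2_\rho[a,b]$ (the limit exists and does not depend on the sequence). *)

theory Defs
  imports "HOL-Probability.Probability"
begin

subsection \<open>Partitions and bounded variation\<close>

definition partition_of :: "real \<Rightarrow> real \<Rightarrow> nat \<Rightarrow> (nat \<Rightarrow> real) \<Rightarrow> bool" where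
  "partition_of a b n t \<longleftrightarrow> t 0 = a \<and> t n = b \<and> (\<forall>i<n. t i < t (Suc i))"

definition bounded_variation_on :: "real \<Rightarrow> real \<Rightarrow> (real \<Rightarrow> real) \<Rightarrow> bool" where
  "bounded_variation_on a b g \<longleftrightarrow>
     bdd_above {(\<Sum>i<n. \<bar>g (t (Suc i)) - g (t i)\<bar>) | n t. partition_of a b n t}"

subsection \<open>Square-integrable functions\<close>

text \<open>Elements are functions, not equivalence classes modulo null sets.\<close>

definition L2_space :: "'a measure \<Rightarrow> ('a \<Rightarrow> real) set" where
  "L2_space M = {f \<in> borel_measurable M. integrable M (\<lambda>x. \<bar>f x\<bar>\<^sup>2)}"

definition L2_inner :: "'a measure \<Rightarrow> ('a \<Rightarrow> real) \<Rightarrow> ('a \<Rightarrow> real) \<Rightarrow> real" where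
  "L2_inner M f g = (\<integral>x. f x * g x \<partial>M)"

definition L2_norm :: "'a measure \<Rightarrow> ('a \<Rightarrow> real) \<Rightarrow> real" where
  "L2_norm M f = sqrt (L2_inner M f f)"

definition L2_tendsto :: "'a measure \<Rightarrow> (nat \<Rightarrow> 'a \<Rightarrow> real) \<Rightarrow> ('a \<Rightarrow> real) \<Rightarrow> bool" where
  "L2_tendsto M F f \<longleftrightarrow>
     (\<forall>k. F k \<in> L2_space M) \<and> f \<in> L2_space M \<and>
     (\<lambda>k. L2_norm M (\<lambda>x. F k x - f x)) \<longlonglongrightarrow> 0"

text \<open>An orthonormal sequence whose finite linear combinations are dense.\<close>

definition L2_orthonormal_basis :: "'a measure \<Rightarrow> (nat \<Rightarrow> 'a \<Rightarrow> real) \<Rightarrow> bool" where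
  "L2_orthonormal_basis M \<phi> \<longleftrightarrow>
     (\<forall>n. \<phi> n \<in> L2_space M) \<and>
     (\<forall>m n. L2_inner M (\<phi> m) (\<phi> n) = (if m = n then 1 else 0)) \<and>
     (\<forall>f\<in>L2_space M. \<forall>\<epsilon>>0. \<exists>N c. L2_norm M (\<lambda>x. f x - (\<Sum>n<N. c n * \<phi> n x)) < \<epsilon>)"

subsection \<open>The Lebesgue-Stieltjes measure on an interval\<close>

text \<open>Only the values of \<open>\<rho>\<close> on \<open>{a..b}\<close> matter: \<open>\<rho>\<close> is extended by constants outside the
  interval before \<^const>\<open>interval_measure\<close> (which wants a function on the whole line) is applied.
  The measure is completed, as \<^const>\<open>lebesgue_on\<close> is.\<close>

definition stieltjes_on :: "real \<Rightarrow> real \<Rightarrow> (real \<Rightarrow> real) \<Rightarrow> real measure" where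
  "stieltjes_on a b \<rho> =
     restrict_space (completion (interval_measure (\<lambda>t. \<rho> (max a (min b t))))) {a..b}"

subsection \<open>Yeh processes\<close>

locale yeh_functions =
  fixes a b :: real and lam \<rho> :: "real \<Rightarrow> real"
  assumes interval: "0 \<le> a" "a < b"
    and continuous_lam: "continuous_on {a..b} lam"
    and bounded_variation_lam: "bounded_variation_on a b lam"
    and continuous_rho: "continuous_on {a..b} \<rho>"
    and mono_rho: "mono_on {a..b} \<rho>"
    and rho_equivalent_lebesgue:
      "absolutely_continuous (lebesgue_on {a..b}) (stieltjes_on a b \<rho>)"
      "absolutely_continuous (stieltjes_on a b \<rho>) (lebesgue_on {a..b})"

text \<open>\<^const>\<open>normal_density\<close> is parametrised by the standard deviation, not the variance.
  The standing assumptions make \<open>\<rho>\<close> strictly increasing, so it is positive below.\<close>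

locale yeh_process = prob_space M + yeh_functions a b lam \<rho>
  for M :: "'w measure" and a b :: real and lam \<rho> :: "real \<Rightarrow> real" +
  fixes X :: "real \<Rightarrow> 'w \<Rightarrow> real"
  assumes random_variable_X: "\<And>t. t \<in> {a..b} \<Longrightarrow> random_variable borel (X t)"
    and continuous_paths: "AE \<omega> in M. continuous_on {a..b} (\<lambda>t. X t \<omega>)"
    and independent_increments:
      "\<And>n t. \<lbrakk>a \<le> t 0; t n \<le> b; \<forall>i<n. t i < t (Suc i)\<rbrakk> \<Longrightarrow>
         indep_vars (\<lambda>_. borel) (\<lambda>i \<omega>. X (t (Suc i)) \<omega> - X (t i) \<omega>) {..<n}"
    and normal_increments:
      "\<And>s t. \<lbrakk>a \<le> s; s < t; t \<le> b\<rbrakk> \<Longrightarrow>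
         distributed M lborel (\<lambda>\<omega>. X t \<omega> - X s \<omega>)
           (\<lambda>x. ennreal (normal_density (lam t - lam s) (sqrt (\<rho> t - \<rho> s)) x))"

definition centered :: "(real \<Rightarrow> real) \<Rightarrow> (real \<Rightarrow> 'w \<Rightarrow> real) \<Rightarrow> real \<Rightarrow> 'w \<Rightarrow> real" where
  "centered lam X = (\<lambda>t \<omega>. X t \<omega> - lam t)"

subsection \<open>The Wiener integral\<close>

definition step_function :: "nat \<Rightarrow> (nat \<Rightarrow> real) \<Rightarrow> (nat \<Rightarrow> real) \<Rightarrow> real \<Rightarrow> real" where
  "step_function n t c = (\<lambda>x. \<Sum>i<n. c i * indicator {t i..<t (Suc i)} x)"

definition step_integral ::
    "(real \<Rightarrow> 'w \<Rightarrow> real) \<Rightarrow> nat \<Rightarrow> (nat \<Rightarrow> real) \<Rightarrow> (nat \<Rightarrow> real) \<Rightarrow> 'w \<Rightarrow> real" where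
  "step_integral X n t c = (\<lambda>\<omega>. \<Sum>i<n. c i * (X (t (Suc i)) \<omega> - X (t i) \<omega>))"

text \<open>The integral of a step function is taken from the data \<open>(n, t, c)\<close> presenting it; the
  condition ranges over all presentations of all approximating step functions.\<close>

definition is_wiener_integral ::
    "'w measure \<Rightarrow> real \<Rightarrow> real \<Rightarrow> (real \<Rightarrow> real) \<Rightarrow> (real \<Rightarrow> 'w \<Rightarrow> real) \<Rightarrow>
     (real \<Rightarrow> real) \<Rightarrow> ('w \<Rightarrow> real) \<Rightarrow> bool" where
  "is_wiener_integral M a b \<rho> X f Y \<longleftrightarrow>
     Y \<in> L2_space M \<and>
     (\<forall>n t c. (\<forall>k. partition_of a b (n k) (t k)) \<longrightarrow>
        L2_tendsto (stieltjes_on a b \<rho>) (\<lambda>k. step_function (n k) (t k) (c k)) f \<longrightarrow>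
        L2_tendsto M (\<lambda>k. step_integral X (n k) (t k) (c k)) Y)"

text \<open>The \<open>L\<^sup>2\<close>-limit is determined only almost everywhere; a representative is chosen.\<close>

definition wiener_integral ::
    "'w measure \<Rightarrow> real \<Rightarrow> real \<Rightarrow> (real \<Rightarrow> real) \<Rightarrow> (real \<Rightarrow> 'w \<Rightarrow> real) \<Rightarrow>
     (real \<Rightarrow> real) \<Rightarrow> 'w \<Rightarrow> real" where
  "wiener_integral M a b \<rho> X f = (SOME Y. is_wiener_integral M a b \<rho> X f Y)"

end

theory Submission
  imports Defs
begin

text \<open>
  The Wiener integral is a linear isometry from \<open>L\<^sup>2(\<rho>)\<close> into \<open>L\<^sup>2(\<Omega>)\<close>, and it carries the
  Fourier expansion \<open>f = \<Sum>n. \<langle>f, \<phi> n\<rangle> \<phi> n\<close> term by term to the random series; hence the series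
  converges in \<open>L\<^sup>2(\<Omega>)\<close>. On step functions the isometry is a covariance computation: the variance
  of an increment of the centered process is an increment of \<open>\<rho>\<close>, and by polarization
  (\<open>increment_covariance\<close>) the covariance of two increments is the \<open>\<rho>\<close>-measure of the
  intersection of the two intervals. Density of step functions (\<open>uniform_steps_dense\<close>) and
  completeness of \<open>L\<^sup>2(\<Omega>)\<close> (\<open>L2_complete\<close>) extend it to all of \<open>L\<^sup>2(\<rho>)\<close>.

  Almost sure convergence uses more than orthogonality of the terms. The integral of a step
  function \<open>g\<close> is a sum of independent centered normal variables, so it is centered normal and its
  fourth moment is \<open>3 * \<parallel>g\<parallel>\<^sup>4\<close>. In the limit, every \<open>g\<close> in \<open>L\<^sup>2(\<rho>)\<close> has an integral whose fourth
  moment is at most \<open>3 * \<parallel>g\<parallel>\<^sup>4\<close>. For a block \<open>S j - S i\<close> of the random series, with Fourier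
  coefficients \<open>c n\<close>, this reads \<open>E (S j - S i)\<^sup>4 \<le> 3 * (\<Sum>n=i..<j. (c n)\<^sup>2)\<^sup>2\<close>.
  Because of the outer square, cutting a block into two parts of equal weight halves the sum of the
  bounds, and repeated bisection gives the same bound, with a larger constant, for the expectation
  of the maximum of \<open>(S k - S i)\<^sup>4\<close> over the block (\<open>maximal_fourth_moment\<close>). By Bessel's
  inequality the tails of \<open>\<Sum>n. (c n)\<^sup>2\<close> vanish, so the oscillation of the partial sums after an
  index \<open>i\<close> tends to zero in the fourth mean as \<open>i\<close> grows, and
  Fatou's lemma turns this into almost sure convergence (\<open>AE_convergent_of_fourth_moments\<close>).
\<close>

section \<open>The space of square-integrable functions\<close>

lemma L2_space_iff:
  "f \<in> L2_space M \<longleftrightarrow> f \<in> borel_measurable M \<and> integrable M (\<lambda>x. (f x)\<^sup>2)"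
  by (simp add: L2_space_def)

lemma L2_space_measurable: "f \<in> L2_space M \<Longrightarrow> f \<in> borel_measurable M"
  and L2_space_square: "f \<in> L2_space M \<Longrightarrow> integrable M (\<lambda>x. (f x)\<^sup>2)"
  by (simp_all add: L2_space_iff)

lemma L2_mult_integrable:
  assumes "f \<in> L2_space M" "g \<in> L2_space M"
  shows "integrable M (\<lambda>x. f x * g x)"
proof (rule Bochner_Integration.integrable_bound)
  show "integrable M (\<lambda>x. (f x)\<^sup>2 + (g x)\<^sup>2)"
    using assms by (simp add: L2_space_iff)
  show "(\<lambda>x. f x * g x) \<in> borel_measurable M"
    using assms by (auto simp: L2_space_iff)
  have "\<bar>u * v\<bar> \<le> u\<^sup>2 + v\<^sup>2" for u v :: real
    using sum_squares_bound[of "\<bar>u\<bar>" "\<bar>v\<bar>"] abs_ge_zero[of "u * v"]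
    unfolding abs_mult power2_abs by linarith
  then show "AE x in M. norm (f x * g x) \<le> norm ((f x)\<^sup>2 + (g x)\<^sup>2)"
    by simp
qed

lemma L2_space_cmult: "f \<in> L2_space M \<Longrightarrow> (\<lambda>x. c * f x) \<in> L2_space M"
  by (auto simp: L2_space_iff power_mult_distrib)

lemma L2_space_add:
  assumes "f \<in> L2_space M" "g \<in> L2_space M"
  shows "(\<lambda>x. f x + g x) \<in> L2_space M"
  using assms L2_mult_integrable[OF assms] by (auto simp: L2_space_iff power2_sum mult.assoc)

lemma L2_space_diff:
  assumes "f \<in> L2_space M" "g \<in> L2_space M"
  shows "(\<lambda>x. f x - g x) \<in> L2_space M"
  using L2_space_add[OF assms(1) L2_space_cmult[OF assms(2), of "-1"]] by simp

lemma L2_space_sum: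
  "(\<And>i. i \<in> I \<Longrightarrow> f i \<in> L2_space M) \<Longrightarrow> (\<lambda>x. \<Sum>i\<in>I. f i x) \<in> L2_space M"
proof (induction I rule: infinite_finite_induct)
  case (insert i I)
  then show ?case using L2_space_add[of "f i" M "\<lambda>x. \<Sum>i\<in>I. f i x"] by simp
qed (simp_all add: L2_space_iff)

lemma L2_norm_nonneg: "0 \<le> L2_norm M f"
  by (simp add: L2_norm_def L2_inner_def)

lemma L2_norm_square: "(L2_norm M f)\<^sup>2 = (\<integral>x. (f x)\<^sup>2 \<partial>M)"
  by (simp add: L2_norm_def L2_inner_def power2_eq_square)

lemma L2_norm_minus_commute: "L2_norm M (\<lambda>x. f x - g x) = L2_norm M (\<lambda>x. g x - f x)"
  unfolding L2_norm_def L2_inner_def by (simp add: algebra_simps)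

lemma L2_norm_cmult: "L2_norm M (\<lambda>x. c * f x) = \<bar>c\<bar> * L2_norm M f"
proof -
  have "(L2_norm M (\<lambda>x. c * f x))\<^sup>2 = (\<bar>c\<bar> * L2_norm M f)\<^sup>2"
    by (simp add: L2_norm_square power_mult_distrib)
  then show ?thesis
    by (simp add: L2_norm_nonneg power2_eq_iff_nonneg)
qed

lemma L2_norm_zero: "L2_norm M (\<lambda>x. 0) = 0"
  by (simp add: L2_norm_def L2_inner_def)

lemma nn_integral_square_L2:
  "f \<in> L2_space M \<Longrightarrow> (\<integral>\<^sup>+x. ennreal ((f x)\<^sup>2) \<partial>M) = ennreal ((L2_norm M f)\<^sup>2)"
  by (simp add: L2_space_iff L2_norm_square nn_integral_eq_integral)

lemma L2_norm_square_add:
  assumes "f \<in> L2_space M" "g \<in> L2_space M"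
  shows "(L2_norm M (\<lambda>x. f x + g x))\<^sup>2 = (L2_norm M f)\<^sup>2 + 2 * L2_inner M f g + (L2_norm M g)\<^sup>2"
  using assms L2_mult_integrable[OF assms]
  by (simp add: L2_norm_square L2_inner_def L2_space_iff power2_sum mult.assoc)

lemma L2_inner_commute: "L2_inner M f g = L2_inner M g f"
  by (simp add: L2_inner_def mult.commute)

lemma L2_inner_cmult_right: "L2_inner M f (\<lambda>x. c * g x) = c * L2_inner M f g"
  by (simp add: L2_inner_def mult.left_commute)

lemma L2_inner_sum_right:
  assumes "f \<in> L2_space M" "\<And>i. i \<in> I \<Longrightarrow> g i \<in> L2_space M"
  shows "L2_inner M f (\<lambda>x. \<Sum>i\<in>I. g i x) = (\<Sum>i\<in>I. L2_inner M f (g i))"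
  unfolding L2_inner_def sum_distrib_left
  using assms by (intro Bochner_Integration.integral_sum L2_mult_integrable) auto

lemma L2_norm_square_diff:
  assumes "f \<in> L2_space M" "g \<in> L2_space M"
  shows "(L2_norm M (\<lambda>x. f x - g x))\<^sup>2 = (L2_norm M f)\<^sup>2 - 2 * L2_inner M f g + (L2_norm M g)\<^sup>2"
  using L2_norm_square_add[OF assms(1) L2_space_cmult[OF assms(2), of "-1"]]
    L2_norm_cmult[of M "-1" g] L2_inner_cmult_right[of M f "-1" g] by simp

lemma L2_norm_square_inner: "(L2_norm M f)\<^sup>2 = L2_inner M f f"
  unfolding L2_norm_square by (simp add: L2_inner_def power2_eq_square)

lemma L2_inner_combinations:
  assumes "\<And>i. i \<in> I \<Longrightarrow> f i \<in> L2_space M" "\<And>j. j \<in> J \<Longrightarrow> g j \<in> L2_space M"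
  shows "L2_inner M (\<lambda>x. \<Sum>i\<in>I. c i * f i x) (\<lambda>x. \<Sum>j\<in>J. d j * g j x)
    = (\<Sum>i\<in>I. \<Sum>j\<in>J. c i * d j * L2_inner M (f i) (g j))"
proof -
  have f: "(\<lambda>x. \<Sum>i\<in>I. c i * f i x) \<in> L2_space M"
    by (intro L2_space_sum L2_space_cmult assms)
  have "L2_inner M (\<lambda>x. \<Sum>i\<in>I. c i * f i x) (\<lambda>x. \<Sum>j\<in>J. d j * g j x)
      = (\<Sum>j\<in>J. d j * L2_inner M (g j) (\<lambda>x. \<Sum>i\<in>I. c i * f i x))"
    using assms f by (subst L2_inner_sum_right)
      (simp_all add: L2_space_cmult L2_inner_cmult_right L2_inner_commute[of M "g _"])
  also have "\<dots> = (\<Sum>j\<in>J. d j * (\<Sum>i\<in>I. c i * L2_inner M (f i) (g j)))"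
    using assms by (intro sum.cong refl, subst L2_inner_sum_right)
      (simp_all add: L2_space_cmult L2_inner_cmult_right L2_inner_commute[of M "g _"])
  also have "\<dots> = (\<Sum>i\<in>I. \<Sum>j\<in>J. c i * d j * L2_inner M (f i) (g j))"
    by (subst sum.swap) (simp add: sum_distrib_left mult_ac)
  finally show ?thesis .
qed

text \<open>The triangle inequality follows from Cauchy-Schwarz, and Cauchy-Schwarz from the fact that the
  quadratic form \<open>(s, t) \<mapsto> \<parallel>s f + t g\<parallel>\<^sup>2\<close> has no negative value.\<close>
lemma L2_norm_triangle:
  assumes f: "f \<in> L2_space M" and g: "g \<in> L2_space M"
  shows "L2_norm M (\<lambda>x. f x + g x) \<le> L2_norm M f + L2_norm M g"
proof -
  let ?A = "L2_norm M f" and ?C = "L2_norm M g" and ?B = "L2_inner M f g"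
  have quad: "0 \<le> s\<^sup>2 * ?A\<^sup>2 + 2 * (s * t * ?B) + t\<^sup>2 * ?C\<^sup>2" for s t
  proof -
    have "0 \<le> (L2_norm M (\<lambda>x. s * f x + t * g x))\<^sup>2"
      by simp
    also have "\<dots> = s\<^sup>2 * ?A\<^sup>2 + 2 * (s * t * ?B) + t\<^sup>2 * ?C\<^sup>2"
      by (subst L2_norm_square_add[OF L2_space_cmult[OF f] L2_space_cmult[OF g]])
         (simp add: L2_norm_cmult L2_inner_cmult_right L2_inner_commute[of M "\<lambda>x. s * f x"]
            L2_inner_commute[of M g] power_mult_distrib)
    finally show ?thesis .
  qed
  have "?B \<le> ?A * ?C"
  proof (cases "?A = 0 \<or> ?C = 0")
    case True
    show ?thesis
    proof (rule ccontr)
      \<comment> \<open>for a degenerate form a positive mixed term would produce the value \<open>-1\<close>\<close>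
      assume "\<not> ?thesis"
      then have B: "?B > 0" using True by auto
      from True show False
      proof
        assume "?A = 0"
        then show False using quad[of "- (?C\<^sup>2 + 1) / (2 * ?B)" 1] B by (simp add: field_simps)
      next
        assume "?C = 0"
        then show False using quad[of 1 "- (?A\<^sup>2 + 1) / (2 * ?B)"] B by (simp add: field_simps)
      qed
    qed
  next
    case False
    then have pos: "0 < ?A * ?C"
      using L2_norm_nonneg[of M f] L2_norm_nonneg[of M g] by (simp add: less_le)
    have "0 \<le> 2 * (?A * ?C) * (?A * ?C - ?B)"
      using quad[of ?C "- ?A"] by (simp add: power2_eq_square algebra_simps)
    then show ?thesis
      using pos by (simp add: zero_le_mult_iff)
  qed
  then have "(L2_norm M (\<lambda>x. f x + g x))\<^sup>2 \<le> (?A + ?C)\<^sup>2"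
    by (simp add: L2_norm_square_add[OF f g] power2_sum)
  then show ?thesis
    by (rule power2_le_imp_le) (simp add: L2_norm_nonneg)
qed

lemma L2_norm_triangle_diff:
  assumes "f \<in> L2_space M" "g \<in> L2_space M" "h \<in> L2_space M"
  shows "L2_norm M (\<lambda>x. f x - h x) \<le> L2_norm M (\<lambda>x. f x - g x) + L2_norm M (\<lambda>x. g x - h x)"
  using L2_norm_triangle[OF L2_space_diff[OF assms(1,2)] L2_space_diff[OF assms(2,3)]] by simp

lemma L2_norm_diff_ineq:
  assumes f: "f \<in> L2_space M" and g: "g \<in> L2_space M"
  shows "\<bar>L2_norm M f - L2_norm M g\<bar> \<le> L2_norm M (\<lambda>x. f x - g x)"
  using L2_norm_triangle[OF L2_space_diff[OF f g] g] L2_norm_triangle[OF L2_space_diff[OF g f] f]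
    L2_norm_minus_commute[of M f g] by simp

lemma L2_tendsto_norm:
  assumes "L2_tendsto M F f"
  shows "(\<lambda>k. L2_norm M (F k)) \<longlonglongrightarrow> L2_norm M f"
proof -
  have "(\<lambda>k. L2_norm M (F k) - L2_norm M f) \<longlonglongrightarrow> 0"
  proof (rule Lim_null_comparison)
    show "\<forall>\<^sub>F k in sequentially. norm (L2_norm M (F k) - L2_norm M f) \<le> L2_norm M (\<lambda>x. F k x - f x)"
      using assms by (auto simp: L2_tendsto_def intro!: always_eventually L2_norm_diff_ineq)
  qed (use assms in \<open>simp add: L2_tendsto_def\<close>)
  then show ?thesis by (simp add: LIM_zero_iff)
qed

lemma L2_tendsto_cmult:
  assumes "L2_tendsto M F f"
  shows "L2_tendsto M (\<lambda>k x. c * F k x) (\<lambda>x. c * f x)"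
proof -
  have "(\<lambda>k. \<bar>c\<bar> * L2_norm M (\<lambda>x. F k x - f x)) \<longlonglongrightarrow> \<bar>c\<bar> * 0"
    using assms by (intro tendsto_mult_left) (simp add: L2_tendsto_def)
  then show ?thesis
    using assms by (simp add: L2_tendsto_def L2_space_cmult L2_norm_cmult flip: right_diff_distrib)
qed

lemma L2_tendsto_add:
  assumes F: "L2_tendsto M F f" and G: "L2_tendsto M G g"
  shows "L2_tendsto M (\<lambda>k x. F k x + G k x) (\<lambda>x. f x + g x)"
proof -
  have "(\<lambda>k. L2_norm M (\<lambda>x. F k x + G k x - (f x + g x))) \<longlonglongrightarrow> 0"
  proof (rule Lim_null_comparison)
    have "L2_norm M (\<lambda>x. (F k x - f x) + (G k x - g x))
        \<le> L2_norm M (\<lambda>x. F k x - f x) + L2_norm M (\<lambda>x. G k x - g x)" for k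
      using F G by (intro L2_norm_triangle L2_space_diff) (auto simp: L2_tendsto_def)
    then show "\<forall>\<^sub>F k in sequentially. norm (L2_norm M (\<lambda>x. F k x + G k x - (f x + g x)))
        \<le> L2_norm M (\<lambda>x. F k x - f x) + L2_norm M (\<lambda>x. G k x - g x)"
      by (simp add: L2_norm_nonneg algebra_simps)
    show "(\<lambda>k. L2_norm M (\<lambda>x. F k x - f x) + L2_norm M (\<lambda>x. G k x - g x)) \<longlonglongrightarrow> 0"
      using F G by (intro tendsto_add_zero) (auto simp: L2_tendsto_def)
  qed
  then show ?thesis
    using F G by (simp add: L2_tendsto_def L2_space_add)
qed

text \<open>Fatou's lemma in the form in which it carries moment bounds over to almost everywhere limits.\<close>
lemma nn_integral_limit_le:
  fixes u :: "nat \<Rightarrow> 'a \<Rightarrow> real"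
  assumes [measurable]: "\<And>k. u k \<in> borel_measurable M"
    and bound: "\<And>k. (\<integral>\<^sup>+x. ennreal (u k x) \<partial>M) \<le> ennreal (C k)" and C: "C \<longlonglongrightarrow> c"
    and lim: "AE x in M. (\<lambda>k. u k x) \<longlonglongrightarrow> v x"
  shows "(\<integral>\<^sup>+x. ennreal (v x) \<partial>M) \<le> ennreal c"
proof -
  have "(\<integral>\<^sup>+x. ennreal (v x) \<partial>M) = (\<integral>\<^sup>+x. liminf (\<lambda>k. ennreal (u k x)) \<partial>M)"
    using lim by (intro nn_integral_cong_AE)
      (auto elim!: eventually_mono intro!: lim_imp_Liminf[symmetric] tendsto_ennrealI)
  also have "\<dots> \<le> liminf (\<lambda>k. \<integral>\<^sup>+x. ennreal (u k x) \<partial>M)"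
    by (intro nn_integral_liminf) simp
  also have "\<dots> \<le> liminf (\<lambda>k. ennreal (C k))"
    using bound by (intro Liminf_mono always_eventually) auto
  also have "\<dots> = ennreal c"
    using C by (intro lim_imp_Liminf tendsto_ennrealI) auto
  finally show ?thesis .
qed

lemma L2_norm_leI:
  assumes f: "f \<in> borel_measurable M" and le: "(\<integral>\<^sup>+x. ennreal ((f x)\<^sup>2) \<partial>M) \<le> ennreal (c\<^sup>2)" and "0 \<le> c"
  shows "f \<in> L2_space M" "L2_norm M f \<le> c"
proof -
  show f2: "f \<in> L2_space M"
    unfolding L2_space_iff using f le
    by (auto intro!: integrableI_nonneg order.strict_trans1[OF le])
  show "L2_norm M f \<le> c"
    using le \<open>0 \<le> c\<close> by (auto simp: nn_integral_square_L2[OF f2] intro: power2_le_imp_le)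
qed

lemma L2_tendsto_AE_subseq:
  assumes "L2_tendsto M F f"
  shows "\<exists>r. strict_mono r \<and> (AE x in M. (\<lambda>k. F (r k) x) \<longlonglongrightarrow> f x)"
proof -
  have mem: "F k \<in> L2_space M" "f \<in> L2_space M" for k
    using assms by (simp_all add: L2_tendsto_def)
  have "(\<lambda>k. (L2_norm M (\<lambda>x. F k x - f x))\<^sup>2) \<longlonglongrightarrow> 0\<^sup>2"
    using assms by (intro tendsto_power) (simp add: L2_tendsto_def)
  then have "(\<lambda>k. \<integral>x. norm ((F k x - f x)\<^sup>2) \<partial>M) \<longlonglongrightarrow> 0"
    by (simp add: L2_norm_square)
  then have "\<exists>r. strict_mono r \<and> (AE x in M. (\<lambda>k. (F (r k) x - f x)\<^sup>2) \<longlonglongrightarrow> 0)"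
    by (intro tendsto_L1_AE_subseq) (auto intro!: L2_space_square L2_space_diff mem)
  then obtain r where r: "strict_mono r" "AE x in M. (\<lambda>k. (F (r k) x - f x)\<^sup>2) \<longlonglongrightarrow> 0"
    by blast
  have "(\<lambda>k. F (r k) x) \<longlonglongrightarrow> f x" if "(\<lambda>k. (F (r k) x - f x)\<^sup>2) \<longlonglongrightarrow> 0" for x
    using tendsto_real_sqrt[OF that] by (simp add: tendsto_rabs_zero_iff LIM_zero_iff)
  with r show ?thesis by (auto elim!: eventually_mono)
qed

text \<open>Riesz-Fischer. Along a subsequence whose increments \<open>d k\<close> have norm below \<open>(1/4) ^ k\<close> even the weighted
  sum \<open>\<Sum>k. 2 ^ k * (d k)\<^sup>2\<close> is integrable, hence finite almost everywhere, and
  \<open>\<bar>d k\<bar> \<le> 2 ^ k * (d k)\<^sup>2 + (1/2) ^ k\<close> then makes the increments absolutely summable. The weights are what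
  makes the argument work on a measure space of infinite total mass.\<close>
lemma L2_complete:
  assumes F: "\<And>k. F k \<in> L2_space M"
    and Cauchy: "\<And>e. 0 < e \<Longrightarrow> \<exists>N. \<forall>m\<ge>N. \<forall>n\<ge>N. L2_norm M (\<lambda>x. F m x - F n x) < e"
  shows "\<exists>f. L2_tendsto M F f"
proof -
  have [measurable]: "F k \<in> borel_measurable M" for k
    using F by (rule L2_space_measurable)
  have "\<exists>N. \<forall>k. \<forall>m\<ge>N k. \<forall>n\<ge>N k. L2_norm M (\<lambda>x. F m x - F n x) < (1/4) ^ k"
    by (rule choice) (auto intro!: Cauchy)
  then obtain N where N: "\<And>k m n. N k \<le> m \<Longrightarrow> N k \<le> n \<Longrightarrow> L2_norm M (\<lambda>x. F m x - F n x) < (1/4) ^ k"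
    by blast
  \<comment> \<open>the partial sums are a monotone sequence of indices above \<open>N\<close>\<close>
  define r where "r k = (\<Sum>j\<le>k. N j)" for k
  have r: "N j \<le> r k" if "j \<le> k" for j k
    unfolding r_def using that by (intro member_le_sum) auto
  define d where "d k x = F (r (Suc k)) x - F (r k) x" for k x
  have [measurable]: "d k \<in> borel_measurable M" for k
    unfolding d_def by measurable
  have d_int: "(\<integral>\<^sup>+x. ennreal (2 ^ k * (d k x)\<^sup>2) \<partial>M) \<le> ennreal ((1/8) ^ k)" for k
  proof -
    have dL: "d k \<in> L2_space M"
      unfolding d_def by (intro L2_space_diff F)
    have "(\<integral>\<^sup>+x. ennreal (2 ^ k * (d k x)\<^sup>2) \<partial>M) = ennreal (2 ^ k) * ennreal ((L2_norm M (d k))\<^sup>2)"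
      by (simp add: ennreal_mult nn_integral_cmult nn_integral_square_L2[OF dL])
    also have "\<dots> = ennreal (2 ^ k * (L2_norm M (d k))\<^sup>2)"
      by (simp add: ennreal_mult)
    also have "\<dots> \<le> ennreal (2 ^ k * ((1/4) ^ k)\<^sup>2)"
      using N[of k "r (Suc k)" "r k"] r[of k k] r[of k "Suc k"]
      by (intro ennreal_leI mult_left_mono power_mono L2_norm_nonneg) (auto simp: d_def[abs_def])
    also have "2 ^ k * ((1/4) ^ k)\<^sup>2 = ((1/8) ^ k :: real)"
      by (simp add: power2_eq_square flip: power_mult_distrib)
    finally show ?thesis .
  qed
  have "(\<integral>\<^sup>+x. (\<Sum>k. ennreal (2 ^ k * (d k x)\<^sup>2)) \<partial>M) = (\<Sum>k. \<integral>\<^sup>+x. ennreal (2 ^ k * (d k x)\<^sup>2) \<partial>M)"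
    by (intro nn_integral_suminf) measurable
  also have "\<dots> \<le> (\<Sum>k. ennreal ((1/8) ^ k))"
    by (intro suminf_le d_int) auto
  also have "\<dots> = ennreal (\<Sum>k. (1/8) ^ k)"
    by (intro suminf_ennreal2 summable_geometric) auto
  also have "\<dots> < \<infinity>" by simp
  finally have "AE x in M. (\<Sum>k. ennreal (2 ^ k * (d k x)\<^sup>2)) \<noteq> \<infinity>"
    by (intro nn_integral_PInf_AE) auto
  then have conv: "AE x in M. convergent (\<lambda>k. F (r k) x)"
  proof (rule eventually_mono)
    fix x assume "(\<Sum>k. ennreal (2 ^ k * (d k x)\<^sup>2)) \<noteq> \<infinity>"
    then have "summable (\<lambda>k. 2 ^ k * (d k x)\<^sup>2)"
      by (intro summable_suminf_not_top) auto
    then have "summable (\<lambda>k. 2 ^ k * (d k x)\<^sup>2 + (1/2) ^ k)"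
      by (intro summable_add summable_geometric) auto
    then have "summable (\<lambda>k. d k x)"
    proof (rule summable_comparison_test'[where N = 0])
      fix k :: nat
      \<comment> \<open>weighted arithmetic-geometric mean inequality with weight \<open>2 ^ k\<close>\<close>
      have "2 * (\<bar>d k x\<bar> * 2 ^ k) \<le> (\<bar>d k x\<bar> * 2 ^ k)\<^sup>2 + 1"
        using sum_squares_bound[of "\<bar>d k x\<bar> * 2 ^ k" 1] by simp
      moreover have "0 \<le> \<bar>d k x\<bar> * 2 ^ k" by simp
      ultimately have "\<bar>d k x\<bar> * 2 ^ k \<le> (\<bar>d k x\<bar> * 2 ^ k)\<^sup>2 + 1" by linarith
      then have "\<bar>d k x\<bar> \<le> ((\<bar>d k x\<bar> * 2 ^ k)\<^sup>2 + 1) / 2 ^ k"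
        by (simp add: pos_le_divide_eq)
      also have "\<dots> = 2 ^ k * (d k x)\<^sup>2 + (1/2) ^ k"
        by (simp add: power2_eq_square field_simps power_divide)
      finally show "norm (d k x) \<le> 2 ^ k * (d k x)\<^sup>2 + (1/2) ^ k" by simp
    qed
    then have "convergent (\<lambda>n. \<Sum>k<n. d k x)"
      by (simp add: summable_iff_convergent)
    then have "convergent (\<lambda>n. F (r n) x - F (r 0) x)"
      using sum_lessThan_telescope[of "\<lambda>k. F (r k) x"] by (simp add: d_def)
    then show "convergent (\<lambda>n. F (r n) x)"
      by (simp add: convergent_diff_const_right_iff)
  qed
  define f where "f x = lim (\<lambda>k. F (r k) x)" for x
  have [measurable]: "f \<in> borel_measurable M"
    unfolding f_def by measurable
  have lim: "AE x in M. (\<lambda>k. F (r k) x) \<longlonglongrightarrow> f x"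
    using conv by (rule eventually_mono) (simp add: f_def convergent_LIMSEQ_iff)
  have close: "(\<lambda>x. F n x - f x) \<in> L2_space M \<and> L2_norm M (\<lambda>x. F n x - f x) \<le> (1/4) ^ j"
    if n: "N j \<le> n" for n j
  proof -
    have "(\<integral>\<^sup>+x. ennreal ((F n x - f x)\<^sup>2) \<partial>M) \<le> ennreal (((1/4) ^ j)\<^sup>2)"
    proof (rule nn_integral_limit_le)
      fix k
      have "(\<integral>\<^sup>+x. ennreal ((F n x - F (r (k + j)) x)\<^sup>2) \<partial>M)
          = ennreal ((L2_norm M (\<lambda>x. F n x - F (r (k + j)) x))\<^sup>2)"
        by (intro nn_integral_square_L2 L2_space_diff F)
      also have "\<dots> \<le> ennreal (((1/4) ^ j)\<^sup>2)"
        using N[OF n, of "r (k + j)"] r[of j "k + j"]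
        by (intro ennreal_leI power_mono L2_norm_nonneg) auto
      finally show "(\<integral>\<^sup>+x. ennreal ((F n x - F (r (k + j)) x)\<^sup>2) \<partial>M) \<le> ennreal (((1/4) ^ j)\<^sup>2)" .
    next
      show "AE x in M. (\<lambda>k. (F n x - F (r (k + j)) x)\<^sup>2) \<longlonglongrightarrow> (F n x - f x)\<^sup>2"
        using lim by (rule eventually_mono) (intro tendsto_intros LIMSEQ_ignore_initial_segment)
    qed auto
    then show ?thesis
      by (intro conjI L2_norm_leI) auto
  qed
  have fL: "f \<in> L2_space M"
    using L2_space_diff[OF F[of "N 0"] conjunct1[OF close[of 0 "N 0"]]] by simp
  have "(\<lambda>n. L2_norm M (\<lambda>x. F n x - f x)) \<longlonglongrightarrow> 0"
  proof (rule LIMSEQ_I)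
    fix e :: real assume "0 < e"
    then obtain j where "(1/4) ^ j < e"
      using real_arch_pow_inv[of e "1/4"] by auto
    then show "\<exists>m. \<forall>n\<ge>m. norm (L2_norm M (\<lambda>x. F n x - f x) - 0) < e"
      using close[of j] by (intro exI[of _ "N j"]) (force simp: L2_norm_nonneg)
  qed
  then show ?thesis
    using F fL by (auto simp: L2_tendsto_def)
qed

lemma L2_tendsto_dominated:
  assumes F: "\<And>k. F k \<in> borel_measurable M" and f: "f \<in> borel_measurable M" and w: "w \<in> L2_space M"
    and lim: "AE x in M. (\<lambda>k. F k x) \<longlonglongrightarrow> f x" and bound: "\<And>k. AE x in M. \<bar>F k x\<bar> \<le> w x"
  shows "L2_tendsto M F f"
proof -
  note [measurable] = F f L2_space_measurable[OF w]
  have w2: "integrable M (\<lambda>x. (w x)\<^sup>2)"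
    using w by (rule L2_space_square)
  have sq: "u\<^sup>2 \<le> v\<^sup>2" if "\<bar>u\<bar> \<le> v" for u v :: real
    using that power_mono[of "\<bar>u\<bar>" v 2] by simp
  have FL: "F k \<in> L2_space M" for k
    unfolding L2_space_iff
  proof (intro conjI)
    show "integrable M (\<lambda>x. (F k x)\<^sup>2)"
      by (rule Bochner_Integration.integrable_bound[OF w2])
        (use bound[of k] in \<open>auto elim!: eventually_mono intro: sq\<close>)
  qed measurable
  have bound_all: "AE x in M. \<forall>k. \<bar>F k x\<bar> \<le> w x"
    using bound by (simp add: AE_all_countable)
  have f_bound: "AE x in M. \<bar>f x\<bar> \<le> w x"
    using lim bound_all
  proof eventually_elim
    case (elim x)
    have "(\<lambda>k. \<bar>F k x\<bar>) \<longlonglongrightarrow> \<bar>f x\<bar>"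
      using elim(1) by (rule tendsto_rabs)
    then show ?case
      by (rule LIMSEQ_le_const2) (use elim(2) in auto)
  qed
  have fL: "f \<in> L2_space M"
    unfolding L2_space_iff
  proof (intro conjI)
    show "integrable M (\<lambda>x. (f x)\<^sup>2)"
      by (rule Bochner_Integration.integrable_bound[OF w2])
        (use f_bound in \<open>auto elim!: eventually_mono intro: sq\<close>)
  qed measurable
  have "(\<lambda>k. \<integral>x. (F k x - f x)\<^sup>2 \<partial>M) \<longlonglongrightarrow> (\<integral>x. 0 \<partial>M)"
  proof (rule integral_dominated_convergence[where w = "\<lambda>x. 4 * (w x)\<^sup>2"])
    show "AE x in M. (\<lambda>k. (F k x - f x)\<^sup>2) \<longlonglongrightarrow> 0"
      using lim by eventually_elim (auto intro!: tendsto_eq_intros simp: LIM_zero_iff)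
    show "AE x in M. norm ((F k x - f x)\<^sup>2) \<le> 4 * (w x)\<^sup>2" for k
      using bound[of k] f_bound
    proof eventually_elim
      case (elim x)
      then have "\<bar>F k x - f x\<bar> \<le> 2 * w x" by linarith
      from sq[OF this] show ?case by (simp add: power_mult_distrib)
    qed
  qed (use w2 in auto)
  then have "(\<lambda>k. (L2_norm M (\<lambda>x. F k x - f x))\<^sup>2) \<longlonglongrightarrow> 0"
    by (simp add: L2_norm_square)
  from tendsto_real_sqrt[OF this] show ?thesis
    using FL fL by (simp add: L2_tendsto_def L2_norm_nonneg)
qed

lemma L2_space_bounded:
  assumes "finite_measure M" "f \<in> borel_measurable M" "\<And>x. \<bar>f x\<bar> \<le> B"
  shows "f \<in> L2_space M"
proof -
  interpret finite_measure M by fact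
  have "(f x)\<^sup>2 \<le> B\<^sup>2" for x
    using assms(3)[of x] power_mono[of "\<bar>f x\<bar>" B 2] by simp
  then show ?thesis
    unfolding L2_space_iff using assms(2)
    by (auto intro!: integrable_const_bound[where B = "B\<^sup>2"])
qed

section \<open>Expansion in an orthonormal basis\<close>

lemma orthonormal_norm_square_sum:
  assumes "\<And>n. \<phi> n \<in> L2_space M" "\<And>m n. L2_inner M (\<phi> m) (\<phi> n) = (if m = n then 1 else 0)"
    and "finite I"
  shows "(L2_norm M (\<lambda>x. \<Sum>n\<in>I. c n * \<phi> n x))\<^sup>2 = (\<Sum>n\<in>I. (c n)\<^sup>2)"
proof -
  let ?s = "\<lambda>x. \<Sum>n\<in>I. c n * \<phi> n x"
  have s: "?s \<in> L2_space M"
    by (intro L2_space_sum L2_space_cmult assms)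
  have inner: "L2_inner M (\<phi> m) ?s = c m" if "m \<in> I" for m
    using that assms
    by (simp add: L2_inner_sum_right L2_space_cmult L2_inner_cmult_right if_distrib[of "\<lambda>x. _ * x"] cong: if_cong)
  have "(L2_norm M ?s)\<^sup>2 = L2_inner M ?s ?s"
    unfolding L2_norm_square by (simp add: L2_inner_def power2_eq_square)
  also have "\<dots> = (\<Sum>n\<in>I. c n * L2_inner M ?s (\<phi> n))"
    using s assms by (subst L2_inner_sum_right) (simp_all add: L2_space_cmult L2_inner_cmult_right)
  also have "\<dots> = (\<Sum>n\<in>I. (c n)\<^sup>2)"
    by (intro sum.cong) (simp_all add: L2_inner_commute[of M ?s] inner power2_eq_square)
  finally show ?thesis .
qed

text \<open>Completing the square in the coefficients: the Fourier coefficients give the best approximation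
  by the first \<open>N\<close> basis vectors, and the minimal distance gives Bessel's inequality.\<close>
lemma orthonormal_distance_square:
  fixes \<phi> :: "nat \<Rightarrow> 'a \<Rightarrow> real"
  assumes \<phi>: "\<And>n. \<phi> n \<in> L2_space M" "\<And>m n. L2_inner M (\<phi> m) (\<phi> n) = (if m = n then 1 else 0)"
    and f: "f \<in> L2_space M"
  shows "(L2_norm M (\<lambda>x. f x - (\<Sum>n<N. c n * \<phi> n x)))\<^sup>2
    = (L2_norm M f)\<^sup>2 - (\<Sum>n<N. (L2_inner M f (\<phi> n))\<^sup>2) + (\<Sum>n<N. (c n - L2_inner M f (\<phi> n))\<^sup>2)"
proof -
  have "(L2_norm M (\<lambda>x. f x + (\<Sum>n<N. - c n * \<phi> n x)))\<^sup>2
      = (L2_norm M f)\<^sup>2 + 2 * (\<Sum>n<N. - c n * L2_inner M f (\<phi> n)) + (\<Sum>n<N. (- c n)\<^sup>2)"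
    using f \<phi>(1) by (subst L2_norm_square_add)
      (simp_all only: orthonormal_norm_square_sum[OF \<phi> finite_lessThan] L2_inner_sum_right L2_space_cmult
         L2_inner_cmult_right L2_space_sum)
  also have "\<dots> = (L2_norm M f)\<^sup>2 - (\<Sum>n<N. (L2_inner M f (\<phi> n))\<^sup>2) + (\<Sum>n<N. (c n - L2_inner M f (\<phi> n))\<^sup>2)"
    by (simp add: sum_distrib_left power2_diff sum.distrib sum_subtractf sum_negf algebra_simps)
  finally show ?thesis by (simp add: sum_negf)
qed

text \<open>Any combination of the first \<open>N0\<close> basis vectors that is close to \<open>f\<close> is no better than the
  Fourier sum of length \<open>N0\<close>, and longer Fourier sums only decrease the distance.\<close>
lemma orthonormal_basis_expansion:
  assumes basis: "L2_orthonormal_basis M \<phi>" and f: "f \<in> L2_space M"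
  shows "L2_tendsto M (\<lambda>N x. \<Sum>n<N. L2_inner M f (\<phi> n) * \<phi> n x) f"
    and "summable (\<lambda>n. (L2_inner M f (\<phi> n))\<^sup>2)"
proof -
  let ?a = "\<lambda>n. L2_inner M f (\<phi> n)"
  have \<phi>: "\<And>n. \<phi> n \<in> L2_space M" "\<And>m n. L2_inner M (\<phi> m) (\<phi> n) = (if m = n then 1 else 0)"
    using basis by (auto simp: L2_orthonormal_basis_def)
  note dist = orthonormal_distance_square[OF \<phi> f]
  show "summable (\<lambda>n. (?a n)\<^sup>2)"
  proof (rule summableI_nonneg_bounded)
    show "(\<Sum>n<N. (?a n)\<^sup>2) \<le> (L2_norm M f)\<^sup>2" for N
      using dist[where N = N and c = ?a] zero_le_power2[of "L2_norm M (\<lambda>x. f x - (\<Sum>n<N. ?a n * \<phi> n x))"] by simp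
  qed simp
  have "(\<lambda>N. L2_norm M (\<lambda>x. f x - (\<Sum>n<N. ?a n * \<phi> n x))) \<longlonglongrightarrow> 0"
  proof (rule LIMSEQ_I)
    fix e :: real assume "0 < e"
    then obtain N0 c where N0: "L2_norm M (\<lambda>x. f x - (\<Sum>n<N0. c n * \<phi> n x)) < e"
      using basis f unfolding L2_orthonormal_basis_def by blast
    have "L2_norm M (\<lambda>x. f x - (\<Sum>n<N. ?a n * \<phi> n x)) < e" if "N0 \<le> N" for N
    proof -
      have "(L2_norm M (\<lambda>x. f x - (\<Sum>n<N. ?a n * \<phi> n x)))\<^sup>2 = (L2_norm M f)\<^sup>2 - (\<Sum>n<N. (?a n)\<^sup>2)"
        using dist[where N = N and c = ?a] by simp
      also have "\<dots> \<le> (L2_norm M f)\<^sup>2 - (\<Sum>n<N0. (?a n)\<^sup>2)"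
        using that by (intro diff_left_mono sum_mono2) auto
      also have "\<dots> \<le> (L2_norm M (\<lambda>x. f x - (\<Sum>n<N0. c n * \<phi> n x)))\<^sup>2"
        by (subst dist) (simp add: sum_nonneg)
      finally have "L2_norm M (\<lambda>x. f x - (\<Sum>n<N. ?a n * \<phi> n x))
          \<le> L2_norm M (\<lambda>x. f x - (\<Sum>n<N0. c n * \<phi> n x))"
        by (rule power2_le_imp_le) (rule L2_norm_nonneg)
      with N0 show ?thesis by simp
    qed
    then show "\<exists>N0. \<forall>N\<ge>N0. norm (L2_norm M (\<lambda>x. f x - (\<Sum>n<N. ?a n * \<phi> n x)) - 0) < e"
      by (intro exI[of _ N0]) (simp add: L2_norm_nonneg)
  qed
  then show "L2_tendsto M (\<lambda>N x. \<Sum>n<N. ?a n * \<phi> n x) f"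
    using f \<phi>(1) L2_norm_minus_commute[of M f]
    by (simp add: L2_tendsto_def L2_space_sum L2_space_cmult)
qed

section \<open>Partitions and step functions\<close>

lemma partition_mono:
  assumes "partition_of a b n t" "i \<le> j" "j \<le> n"
  shows "t i \<le> t j"
  using assms(2,3)
proof (induction j rule: dec_induct)
  case (step k)
  then have "t k < t (Suc k)" using assms(1) by (simp add: partition_of_def)
  with step show ?case by simp
qed simp

lemma partition_in_interval:
  assumes "partition_of a b n t" "i \<le> n"
  shows "t i \<in> {a..b}"
  using partition_mono[OF assms(1), of 0 i] partition_mono[OF assms(1), of i n] assms
  by (simp add: partition_of_def)

lemma partition_cell:
  assumes p: "partition_of a b n t" and x: "a \<le> x" "x < b"
  shows "\<exists>i<n. t i \<le> x \<and> x < t (Suc i)"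
proof -
  define i where "i = (LEAST i. x < t i)"
  have "x < t n" using p x by (simp add: partition_of_def)
  then have i: "x < t i" "i \<le> n"
    unfolding i_def by (auto intro: LeastI Least_le)
  have "i \<noteq> 0" using i(1) p x by (cases "i = 0") (auto simp: partition_of_def)
  then obtain k where k: "i = Suc k" by (cases i) auto
  have "\<not> x < t k" using not_less_Least[of k "\<lambda>i. x < t i"] k by (simp add: i_def)
  with i k show ?thesis by (intro exI[of _ k]) auto
qed

lemma step_function_cell:
  assumes p: "partition_of a b n t" and i: "i < n" and x: "t i \<le> x" "x < t (Suc i)"
  shows "step_function n t c x = c i"
proof -
  have "c j * indicator {t j..<t (Suc j)} x = (if j = i then c i else 0)" if "j < n" for j
  proof (cases j i rule: linorder_cases)
    case less
    then show ?thesis using partition_mono[OF p, of "Suc j" i] i x by (simp add: indicator_def)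
  next
    case greater
    then show ?thesis using partition_mono[OF p, of "Suc i" j] that x by (simp add: indicator_def)
  qed (use x in simp)
  then have "step_function n t c x = (\<Sum>j<n. if j = i then c i else 0)"
    unfolding step_function_def by (intro sum.cong) auto
  with i show ?thesis by simp
qed

lemma step_function_outside:
  assumes p: "partition_of a b n t" and x: "x \<notin> {a..<b}"
  shows "step_function n t c x = 0"
  unfolding step_function_def
proof (intro sum.neutral ballI)
  fix i assume "i \<in> {..<n}"
  then show "c i * indicator {t i..<t (Suc i)} x = 0"
    using partition_in_interval[OF p, of i] partition_in_interval[OF p, of "Suc i"] x
    by (auto simp: indicator_def)
qed

lemma step_function_borel: "step_function n t c \<in> borel_measurable borel"
  unfolding step_function_def by measurable

lemma step_function_linear:
  "step_function n t (\<lambda>i. u * c i + v * d i) x = u * step_function n t c x + v * step_function n t d x"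
  by (simp only: step_function_def sum_distrib_left distrib_right sum.distrib mult.assoc)

lemma step_integral_linear:
  "step_integral X n t (\<lambda>i. u * c i + v * d i) \<omega> = u * step_integral X n t c \<omega> + v * step_integral X n t d \<omega>"
  by (simp only: step_integral_def sum_distrib_left distrib_right sum.distrib mult.assoc)

text \<open>All approximations are taken on this one sequence of partitions. Approximating step functions
  of several functions, and their integrals, can then be combined coefficientwise, without
  common refinements. The number of cells is \<open>Suc N\<close>, so that the index \<open>0\<close> gives a partition, too.\<close>
definition uniform_partition :: "real \<Rightarrow> real \<Rightarrow> nat \<Rightarrow> nat \<Rightarrow> real" where
  "uniform_partition a b N i = a + (b - a) * (real i / real (Suc N))"

lemma uniform_partition_Suc:
  "uniform_partition a b N (Suc i) = uniform_partition a b N i + (b - a) / real (Suc N)"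
  by (simp add: uniform_partition_def add_divide_distrib distrib_left)

lemma partition_of_uniform: "a < b \<Longrightarrow> partition_of a b (Suc N) (uniform_partition a b N)"
  unfolding partition_of_def
proof (intro conjI allI impI)
  show "uniform_partition a b N (Suc N) = b"
    unfolding uniform_partition_def by (simp del: of_nat_Suc)
  show "uniform_partition a b N i < uniform_partition a b N (Suc i)" if "a < b" for i
    using that by (simp add: uniform_partition_Suc)
qed (simp add: uniform_partition_def)

abbreviation uniform_step :: "real \<Rightarrow> real \<Rightarrow> nat \<Rightarrow> (nat \<Rightarrow> real) \<Rightarrow> real \<Rightarrow> real" where
  "uniform_step a b N \<equiv> step_function (Suc N) (uniform_partition a b N)"

section \<open>The Lebesgue-Stieltjes measure\<close>

context yeh_functions
begin

abbreviation \<mu> :: "real measure" where "\<mu> \<equiv> stieltjes_on a b \<rho>"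

abbreviation clamp_rho :: "real \<Rightarrow> real" where "clamp_rho \<equiv> \<lambda>t. \<rho> (max a (min b t))"

lemma clamp_rho_mono: "x \<le> y \<Longrightarrow> clamp_rho x \<le> clamp_rho y"
  using interval by (intro mono_onD[OF mono_rho]) auto

lemma clamp_rho_continuous: "continuous_on UNIV clamp_rho"
  using interval
  by (intro continuous_on_compose2[OF continuous_rho] continuous_intros) auto

lemma space_stieltjes [simp]: "space \<mu> = {a..b}"
  by (simp add: stieltjes_on_def space_restrict_space)

lemma sets_stieltjesI: "A \<in> sets borel \<Longrightarrow> A \<subseteq> {a..b} \<Longrightarrow> A \<in> sets \<mu>"
  unfolding stieltjes_on_def by (subst sets_restrict_space_iff) auto

lemma borel_measurable_stieltjes: "f \<in> borel_measurable borel \<Longrightarrow> f \<in> borel_measurable \<mu>"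
  unfolding stieltjes_on_def
  by (intro measurable_restrict_space1 measurable_completion) (simp add: measurable_def)

lemma emeasure_stieltjes_borel:
  assumes "A \<in> sets borel" "A \<subseteq> {a..b}"
  shows "emeasure \<mu> A = emeasure (interval_measure clamp_rho) A"
  unfolding stieltjes_on_def using assms
  by (subst emeasure_restrict_space) (auto simp: emeasure_completion)

lemma emeasure_stieltjes_Icc:
  assumes "a \<le> s" "s \<le> t" "t \<le> b"
  shows "emeasure \<mu> {s..t} = ennreal (\<rho> t - \<rho> s)"
proof -
  have "emeasure \<mu> {s..t} = emeasure (interval_measure clamp_rho) {s..t}"
    using assms by (intro emeasure_stieltjes_borel) auto
  also have "\<dots> = ennreal (clamp_rho t - clamp_rho s)"
    using assms(2) clamp_rho_mono clamp_rho_continuous by (rule emeasure_interval_measure_Icc)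
  finally show ?thesis using assms by (simp add: max_def min_def)
qed

lemma emeasure_stieltjes_singleton: "x \<in> {a..b} \<Longrightarrow> emeasure \<mu> {x} = 0"
  using emeasure_stieltjes_Icc[of x x] by simp

lemma AE_stieltjes_neq: "AE y in \<mu>. y \<noteq> x"
proof (cases "x \<in> {a..b}")
  case True
  then show ?thesis
    using emeasure_stieltjes_singleton[of x] by (intro AE_I[of _ _ "{x}"] sets_stieltjesI) auto
next
  case False
  then show ?thesis by (intro AE_I2) auto
qed

lemma measure_stieltjes_Ico:
  assumes "a \<le> s" "s \<le> t" "t \<le> b"
  shows "measure \<mu> {s..<t} = \<rho> t - \<rho> s"
proof -
  have "emeasure \<mu> {s..<t} = emeasure \<mu> {s..t}"
    using assms AE_stieltjes_neq[of t] by (intro emeasure_eq_AE sets_stieltjesI) auto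
  moreover have "\<rho> s \<le> \<rho> t"
    using assms by (intro mono_onD[OF mono_rho]) auto
  ultimately show ?thesis
    using assms by (simp add: emeasure_stieltjes_Icc measure_def)
qed

lemma finite_measure_stieltjes: "finite_measure \<mu>"
  using emeasure_stieltjes_Icc[of a b] interval by (intro finite_measureI) simp

lemma step_function_L2: "step_function n t c \<in> L2_space \<mu>"
proof (rule L2_space_bounded[OF finite_measure_stieltjes])
  show "step_function n t c \<in> borel_measurable \<mu>"
    by (intro borel_measurable_stieltjes step_function_borel)
  show "\<bar>step_function n t c x\<bar> \<le> (\<Sum>i<n. \<bar>c i\<bar>)" for x
    unfolding step_function_def
    by (rule order_trans[OF sum_abs]) (auto intro!: sum_mono simp: indicator_def)
qed

text \<open>An interval on which \<open>\<rho>\<close> is constant would be a null set for its measure, hence for Lebesgue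
  measure. Strictness is needed because increments of variance zero have no normal density.\<close>
lemma rho_strict_mono:
  assumes "a \<le> s" "s < t" "t \<le> b"
  shows "\<rho> s < \<rho> t"
proof (rule ccontr)
  assume "\<not> \<rho> s < \<rho> t"
  then have "emeasure \<mu> {s..t} = 0"
    using assms by (simp add: emeasure_stieltjes_Icc ennreal_neg)
  then have "{s..t} \<in> null_sets \<mu>"
    using assms by (intro null_setsI sets_stieltjesI) auto
  then have "{s..t} \<in> null_sets (lebesgue_on {a..b})"
    using rho_equivalent_lebesgue(2) by (auto simp: absolutely_continuous_def)
  then have "{s..t} \<in> null_sets lebesgue"
    by (simp add: null_sets_restrict_space)
  from null_setsD1[OF this] show False
    using assms by simp
qed

subsection \<open>Density of step functions\<close>

text \<open>The approximating step function is required on every sufficiently fine partition. This form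
  passes to linear combinations, since two functions are approximated on the same partition.\<close>
definition approximable :: "(real \<Rightarrow> real) \<Rightarrow> bool" where
  "approximable f \<longleftrightarrow> f \<in> L2_space \<mu> \<and>
     (\<forall>e>0. \<forall>\<^sub>F N in sequentially. \<exists>c. L2_norm \<mu> (\<lambda>x. uniform_step a b N c x - f x) < e)"

lemma approximable_linear:
  assumes f: "approximable f" and g: "approximable g"
  shows "approximable (\<lambda>x. u * f x + v * g x)"
  unfolding approximable_def
proof (intro conjI allI impI)
  have fg: "f \<in> L2_space \<mu>" "g \<in> L2_space \<mu>"
    using f g by (auto simp: approximable_def)
  then show "(\<lambda>x. u * f x + v * g x) \<in> L2_space \<mu>"
    by (intro L2_space_add L2_space_cmult)
  fix e :: real assume e: "0 < e"
  define d where "d = e / (\<bar>u\<bar> + \<bar>v\<bar> + 1)"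
  have d: "0 < d" "(\<bar>u\<bar> + \<bar>v\<bar>) * d < e"
    using e by (auto simp: d_def field_simps)
  have "\<forall>\<^sub>F N in sequentially. (\<exists>c. L2_norm \<mu> (\<lambda>x. uniform_step a b N c x - f x) < d) \<and>
      (\<exists>c. L2_norm \<mu> (\<lambda>x. uniform_step a b N c x - g x) < d)"
    using f g d(1) by (intro eventually_conj) (auto simp: approximable_def)
  then show "\<forall>\<^sub>F N in sequentially. \<exists>c. L2_norm \<mu> (\<lambda>x. uniform_step a b N c x - (u * f x + v * g x)) < e"
  proof (rule eventually_mono, elim conjE exE)
    fix N c c' assume c: "L2_norm \<mu> (\<lambda>x. uniform_step a b N c x - f x) < d"
      and c': "L2_norm \<mu> (\<lambda>x. uniform_step a b N c' x - g x) < d"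
    have "L2_norm \<mu> (\<lambda>x. uniform_step a b N (\<lambda>i. u * c i + v * c' i) x - (u * f x + v * g x))
        = L2_norm \<mu> (\<lambda>x. u * (uniform_step a b N c x - f x) + v * (uniform_step a b N c' x - g x))"
      by (simp add: step_function_linear algebra_simps)
    also have "\<dots> \<le> \<bar>u\<bar> * L2_norm \<mu> (\<lambda>x. uniform_step a b N c x - f x)
        + \<bar>v\<bar> * L2_norm \<mu> (\<lambda>x. uniform_step a b N c' x - g x)"
      using fg by (intro order_trans[OF L2_norm_triangle] L2_space_cmult L2_space_diff step_function_L2)
        (simp_all add: L2_norm_cmult)
    also have "\<dots> \<le> \<bar>u\<bar> * d + \<bar>v\<bar> * d"
      using c c' by (intro add_mono mult_left_mono) auto
    also have "\<dots> < e"
      using d by (simp add: distrib_right)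
    finally show "\<exists>c. L2_norm \<mu> (\<lambda>x. uniform_step a b N c x - (u * f x + v * g x)) < e"
      by blast
  qed
qed

lemma approximable_tendsto:
  assumes F: "\<And>k. approximable (F k)" and lim: "L2_tendsto \<mu> F f"
  shows "approximable f"
  unfolding approximable_def
proof (intro conjI allI impI)
  show f: "f \<in> L2_space \<mu>"
    using lim by (simp add: L2_tendsto_def)
  fix e :: real assume e: "0 < e"
  have "(\<lambda>k. L2_norm \<mu> (\<lambda>x. F k x - f x)) \<longlonglongrightarrow> 0"
    using lim by (simp add: L2_tendsto_def)
  then have "\<forall>\<^sub>F k in sequentially. L2_norm \<mu> (\<lambda>x. F k x - f x) < e / 2"
    using e by (intro order_tendstoD) auto
  then obtain k where k: "L2_norm \<mu> (\<lambda>x. F k x - f x) < e / 2"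
    by (auto simp: eventually_sequentially)
  have "\<forall>\<^sub>F N in sequentially. \<exists>c. L2_norm \<mu> (\<lambda>x. uniform_step a b N c x - F k x) < e / 2"
    using F[of k] half_gt_zero[OF e] unfolding approximable_def by blast
  then show "\<forall>\<^sub>F N in sequentially. \<exists>c. L2_norm \<mu> (\<lambda>x. uniform_step a b N c x - f x) < e"
  proof (rule eventually_mono, elim exE)
    fix N c assume c: "L2_norm \<mu> (\<lambda>x. uniform_step a b N c x - F k x) < e / 2"
    have "L2_norm \<mu> (\<lambda>x. uniform_step a b N c x - f x)
        \<le> L2_norm \<mu> (\<lambda>x. uniform_step a b N c x - F k x) + L2_norm \<mu> (\<lambda>x. F k x - f x)"
      using F[of k] f by (intro L2_norm_triangle_diff step_function_L2) (auto simp: approximable_def)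
    with c k show "\<exists>c. L2_norm \<mu> (\<lambda>x. uniform_step a b N c x - f x) < e"
      by (intro exI[of _ c]) simp
  qed
qed

lemma approximable_uniform_step_limit:
  assumes "L2_tendsto \<mu> (\<lambda>N. uniform_step a b N (c N)) f"
  shows "approximable f"
  unfolding approximable_def
proof (intro conjI allI impI)
  fix e :: real assume "0 < e"
  then have "\<forall>\<^sub>F N in sequentially. L2_norm \<mu> (\<lambda>x. uniform_step a b N (c N) x - f x) < e"
    using assms by (intro order_tendstoD) (auto simp: L2_tendsto_def)
  then show "\<forall>\<^sub>F N in sequentially. \<exists>c. L2_norm \<mu> (\<lambda>x. uniform_step a b N c x - f x) < e"
    by (rule eventually_mono) blast
qed (use assms in \<open>simp add: L2_tendsto_def\<close>)

lemma approximable_obtain_sequence: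
  assumes "approximable f"
  obtains c where "L2_tendsto \<mu> (\<lambda>N. uniform_step a b N (c N)) f"
proof -
  let ?n = "\<lambda>N c. L2_norm \<mu> (\<lambda>x. uniform_step a b N c x - f x)"
  \<comment> \<open>nearly best approximations on each partition\<close>
  have "\<exists>c. ?n N c < (INF c. ?n N c) + 1 / real (Suc N)" for N
    using cInf_lessD[of "range (?n N)" "(INF c. ?n N c) + 1 / real (Suc N)"] by auto
  then have "\<exists>c. \<forall>N. ?n N (c N) < (INF c. ?n N c) + 1 / real (Suc N)"
    by (intro choice allI)
  then obtain c where c: "\<And>N. ?n N (c N) < (INF c. ?n N c) + 1 / real (Suc N)"
    by blast
  have "(\<lambda>N. ?n N (c N)) \<longlonglongrightarrow> 0"
  proof (rule order_tendstoI)
    fix e :: real assume e: "0 < e"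
    have "\<forall>\<^sub>F N in sequentially. 1 / real (Suc N) < e / 2"
      using e by (intro order_tendstoD(2)[OF LIMSEQ_inverse_real_of_nat[unfolded inverse_eq_divide]]) simp
    moreover have "\<forall>\<^sub>F N in sequentially. \<exists>c. ?n N c < e / 2"
      using assms half_gt_zero[OF e] unfolding approximable_def by blast
    ultimately show "\<forall>\<^sub>F N in sequentially. ?n N (c N) < e"
    proof eventually_elim
      case (elim N)
      then obtain c' where "?n N c' < e / 2" by blast
      moreover have "(INF c. ?n N c) \<le> ?n N c'"
        by (rule cINF_lower) (auto intro!: bdd_belowI[of _ 0] L2_norm_nonneg)
      ultimately show ?case using c[of N] elim(1) by linarith
    qed
  qed (auto intro: always_eventually less_le_trans L2_norm_nonneg)
  then have "L2_tendsto \<mu> (\<lambda>N. uniform_step a b N (c N)) f"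
    using assms by (simp add: L2_tendsto_def step_function_L2 approximable_def)
  then show ?thesis by (rule that)
qed

lemma approximable_cong_AE:
  assumes f: "approximable f" and g: "g \<in> borel_measurable \<mu>" and eq: "AE x in \<mu>. f x = g x"
  shows "approximable g"
proof (rule approximable_tendsto)
  have fL: "f \<in> L2_space \<mu>" using f by (simp add: approximable_def)
  have "(\<lambda>x. \<bar>f x\<bar>) \<in> L2_space \<mu>"
    using fL by (auto simp: L2_space_iff)
  then show "L2_tendsto \<mu> (\<lambda>k. f) g"
    using fL g eq by (intro L2_tendsto_dominated[where w = "\<lambda>x. \<bar>f x\<bar>"]) (auto simp: L2_space_iff)
qed (rule f)

text \<open>Sampling the indicator at the left end points of the cells reproduces it at every point of
  \<open>[a, b)\<close> other than \<open>\<tau>\<close> once the cells are short; the points \<open>\<tau>\<close> and \<open>b\<close> carry no mass, as \<open>\<rho>\<close> is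
  continuous.\<close>
lemma approximable_lessThan: "approximable (indicator {..<\<tau>})"
proof -
  define c where "c N i = (indicator {..<\<tau>} (uniform_partition a b N i) :: real)" for N i
  have part: "partition_of a b (Suc N) (uniform_partition a b N)" for N
    using interval by (intro partition_of_uniform)
  have "L2_tendsto \<mu> (\<lambda>N. uniform_step a b N (c N)) (indicator {..<\<tau>})"
  proof (rule L2_tendsto_dominated[where w = "\<lambda>x. 1"])
    show "AE x in \<mu>. (\<lambda>N. uniform_step a b N (c N) x) \<longlonglongrightarrow> indicator {..<\<tau>} x"
      using AE_stieltjes_neq[of \<tau>] AE_stieltjes_neq[of b] AE_space
    proof eventually_elim
      case (elim x)
      have "(\<lambda>N. (b - a) * inverse (real (Suc N))) \<longlonglongrightarrow> (b - a) * 0"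
        by (intro tendsto_intros LIMSEQ_inverse_real_of_nat)
      then have "\<forall>\<^sub>F N in sequentially. (b - a) * inverse (real (Suc N)) < \<bar>x - \<tau>\<bar>"
        by (rule order_tendstoD(2)) (use elim in simp)
      then have "\<forall>\<^sub>F N in sequentially. uniform_step a b N (c N) x = indicator {..<\<tau>} x"
      proof (rule eventually_mono)
        fix N assume N: "(b - a) * inverse (real (Suc N)) < \<bar>x - \<tau>\<bar>"
        obtain i where i: "i < Suc N" "uniform_partition a b N i \<le> x" "x < uniform_partition a b N (Suc i)"
          using partition_cell[OF part, of x N] elim by auto
        then show "uniform_step a b N (c N) x = indicator {..<\<tau>} x"
          using N uniform_partition_Suc[of a b N i]
          by (auto simp: step_function_cell[OF part] c_def indicator_def divide_inverse)
      qed
      then show ?case by (rule tendsto_eventually)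
    qed
    show "AE x in \<mu>. \<bar>uniform_step a b N (c N) x\<bar> \<le> 1" for N
    proof (intro AE_I2)
      fix x
      show "\<bar>uniform_step a b N (c N) x\<bar> \<le> 1"
      proof (cases "x \<in> {a..<b}")
        case True
        then obtain i where "i < Suc N" "uniform_partition a b N i \<le> x" "x < uniform_partition a b N (Suc i)"
          using partition_cell[OF part, of x N] by auto
        then show ?thesis
          by (simp add: step_function_cell[OF part] c_def)
      qed (simp add: step_function_outside[OF part])
    qed
  qed (auto intro!: borel_measurable_stieltjes step_function_borel L2_space_bounded[OF finite_measure_stieltjes])
  then show ?thesis by (rule approximable_uniform_step_limit)
qed

text \<open>The approximable sets form a Dynkin system, and the half-lines are a generator of the Borel sets
  closed under intersection.\<close>
lemma approximable_borel_set:
  assumes "A \<in> sets borel"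
  shows "approximable (indicator A)"
proof -
  have "{..<x} \<inter> {..<y} = {..<min x y}" for x y :: real
    by auto
  then have "Int_stable (range lessThan :: real set set)"
    by (simp add: Int_stable_def)
  moreover have "range lessThan \<subseteq> Pow (UNIV :: real set)" by simp
  moreover have "A \<in> sigma_sets UNIV (range lessThan)"
    using assms by (simp add: borel_Iio)
  ultimately show ?thesis
  proof (induction rule: sigma_sets_induct_disjoint)
    case (basic A)
    then show ?case using approximable_lessThan by auto
  next
    case empty
    then show ?case
      using approximable_linear[OF approximable_lessThan approximable_lessThan, of 0 _ 0] by simp
  next
    case (compl A)
    have "approximable (\<lambda>x. 1 * indicator {..<b + 1} x + (-1) * indicator A x)"
      using compl by (intro approximable_linear approximable_lessThan) auto
    then show ?case
    proof (rule approximable_cong_AE)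
      have "UNIV - A \<in> sets borel"
        using compl(1) by (simp add: borel_Iio sigma_sets.Compl)
      then show "indicator (UNIV - A) \<in> borel_measurable \<mu>"
        by (intro borel_measurable_stieltjes) auto
      show "AE x in \<mu>. 1 * indicator {..<b + 1} x + (-1) * indicator A x = (indicator (UNIV - A) x :: real)"
        by (intro AE_I2) (auto simp: indicator_def)
    qed
  next
    case (union A)
    have A[measurable]: "A i \<in> sets borel" for i
      using union(2) by (auto simp: borel_Iio)
    define U where "U n = (\<Union>i<n. A i)" for n
    have [measurable]: "U n \<in> sets borel" for n
      unfolding U_def by measurable
    have U: "approximable (indicator (U n))" for n
    proof (induction n)
      case 0
      then show ?case
        using approximable_linear[OF approximable_lessThan approximable_lessThan, of 0 _ 0]
        by (simp add: U_def indicator_def[abs_def])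
    next
      case (Suc n)
      have "A n \<inter> A i = {}" if "i < n" for i
        using union(1) that by (simp add: disjoint_family_on_def)
      then have "A n \<inter> U n = {}"
        by (auto simp: U_def)
      then have "indicator (U (Suc n)) = (\<lambda>x. 1 * indicator (U n) x + 1 * indicator (A n) x :: real)"
        by (auto simp: U_def fun_eq_iff indicator_def less_Suc_eq)
      then show ?case
        using approximable_linear[OF Suc union(3)[of n], of 1 1] by simp
    qed
    show ?case
    proof (rule approximable_tendsto[OF U])
      have "(\<lambda>n. indicator (U n) x :: real) \<longlonglongrightarrow> indicator (\<Union>i. A i) x" for x
        unfolding U_def by (rule LIMSEQ_indicator_UN)
      then show "L2_tendsto \<mu> (\<lambda>n. indicator (U n)) (indicator (\<Union>i. A i))"
        by (intro L2_tendsto_dominated[where w = "\<lambda>x. 1"])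
          (auto intro!: borel_measurable_stieltjes L2_space_bounded[OF finite_measure_stieltjes] simp: indicator_def)
    qed
  qed
qed

lemma approximable_sum:
  "finite I \<Longrightarrow> (\<And>i. i \<in> I \<Longrightarrow> approximable (f i)) \<Longrightarrow> approximable (\<lambda>x. \<Sum>i\<in>I. u i * f i x)"
proof (induction I rule: finite_induct)
  case empty
  show ?case
    using approximable_linear[OF approximable_lessThan approximable_lessThan, of 0 _ 0] by simp
next
  case (insert i I)
  then show ?case
    using approximable_linear[of "f i" "\<lambda>x. \<Sum>i\<in>I. u i * f i x" "u i" 1] by simp
qed

text \<open>A function measurable for the completed measure agrees almost everywhere with a Borel function,
  which is a dominated limit of simple functions; these are combinations of indicators of Borel
  sets.\<close>
lemma uniform_steps_dense:
  assumes f: "f \<in> L2_space \<mu>"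
  shows "approximable f"
proof -
  let ?\<nu> = "interval_measure clamp_rho"
  have "(\<lambda>x. indicator {a..b} x *\<^sub>R f x) \<in> borel_measurable (completion ?\<nu>)"
    using L2_space_measurable[OF f]
    by (subst borel_measurable_restrict_space_iff[symmetric]) (auto simp: stieltjes_on_def)
  then obtain g where "g \<in> borel_measurable ?\<nu>"
    and g_eq: "AE x in ?\<nu>. indicator {a..b} x *\<^sub>R f x = g x"
    using completion_ex_borel_measurable_real by blast
  then have g[measurable]: "g \<in> borel_measurable borel"
    by (simp add: measurable_def)
  have "AE x in completion ?\<nu>. x \<in> {a..b} \<longrightarrow> f x = g x"
    using AE_completion[OF g_eq] by (rule eventually_mono) auto
  then have fg: "AE x in \<mu>. f x = g x"
    unfolding stieltjes_on_def by (subst AE_restrict_space_iff) auto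
  have g\<mu>: "g \<in> borel_measurable \<mu>"
    by (intro borel_measurable_stieltjes g)
  have gL: "(\<lambda>x. 2 * \<bar>g x\<bar>) \<in> L2_space \<mu>"
  proof -
    have "integrable \<mu> (\<lambda>x. (g x)\<^sup>2)"
      using L2_space_square[OF f]
    proof (rule Bochner_Integration.integrable_bound)
      show "AE x in \<mu>. norm ((g x)\<^sup>2) \<le> norm ((f x)\<^sup>2)"
        using fg by eventually_elim simp
    qed (use g\<mu> in measurable)
    with g\<mu> have "(\<lambda>x. \<bar>g x\<bar>) \<in> L2_space \<mu>" by (auto simp: L2_space_iff)
    then show ?thesis by (rule L2_space_cmult)
  qed
  obtain s where s: "\<And>i. simple_function borel (s i)" "\<And>x. (\<lambda>i. s i x) \<longlonglongrightarrow> g x"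
      "\<And>i x. \<bar>s i x\<bar> \<le> 2 * \<bar>g x\<bar>"
    using borel_measurable_implies_sequence_metric[OF g, of 0] by auto
  have "approximable (s k)" for k
  proof -
    have fin: "finite (range (s k))"
      using s(1)[of k] by (auto simp: simple_function_def)
    have "s k = (\<lambda>x. \<Sum>y\<in>range (s k). y * indicator (s k -` {y}) x)"
      using fin by (auto simp: fun_eq_iff indicator_def sum.delta' if_distrib[of "\<lambda>x. _ * x"] cong: if_cong)
    moreover have "approximable (\<lambda>x. \<Sum>y\<in>range (s k). y * indicator (s k -` {y}) x)"
      using fin s(1)[of k] by (intro approximable_sum approximable_borel_set) (auto simp: simple_function_def)
    ultimately show ?thesis by simp
  qed
  then have "approximable g"
  proof (rule approximable_tendsto)
    show "L2_tendsto \<mu> s g"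
      using s g\<mu> gL borel_measurable_simple_function[OF s(1)]
      by (intro L2_tendsto_dominated[where w = "\<lambda>x. 2 * \<bar>g x\<bar>"]) (auto intro: borel_measurable_stieltjes)
  qed
  then show ?thesis
    using fg by (intro approximable_cong_AE[OF _ L2_space_measurable[OF f]]) auto
qed

end

section \<open>The Wiener integral of step functions\<close>

lemma (in prob_space) normal_second_fourth_moment:
  assumes Y: "distributed M lborel Y (normal_density 0 \<sigma>)" and \<sigma>: "0 < \<sigma>"
  shows "Y \<in> L2_space M" "(L2_norm M Y)\<^sup>2 = \<sigma>\<^sup>2"
    "(\<integral>\<^sup>+\<omega>. ennreal (Y \<omega> ^ 4) \<partial>M) = ennreal (3 * (\<sigma>\<^sup>2)\<^sup>2)"
proof -
  have int: "integrable M (\<lambda>\<omega>. Y \<omega> ^ (2 * k))" for k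
    using integrable.intros[OF normal_moment_even[OF \<sigma>, of 0 k]]
    by (subst distributed_integrable[OF Y, symmetric]) auto
  have ex: "(\<integral>\<omega>. Y \<omega> ^ (2 * k) \<partial>M) = fact (2 * k) / ((2 / \<sigma>\<^sup>2) ^ k * fact k)" for k
    using integral_normal_moment_even[OF \<sigma>, of 0 k]
    by (subst distributed_integral[OF Y, symmetric]) auto
  show "Y \<in> L2_space M"
    using int[of 1] distributed_measurable[OF Y] by (simp add: L2_space_iff)
  show "(L2_norm M Y)\<^sup>2 = \<sigma>\<^sup>2"
    using ex[of 1] by (simp add: L2_norm_square)
  have "(\<integral>\<^sup>+\<omega>. ennreal (Y \<omega> ^ 4) \<partial>M) = ennreal (\<integral>\<omega>. Y \<omega> ^ 4 \<partial>M)"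
    using int[of 2] by (intro nn_integral_eq_integral) auto
  also have "(\<integral>\<omega>. Y \<omega> ^ 4 \<partial>M) = 3 * (\<sigma>\<^sup>2)\<^sup>2"
    using ex[of 2] \<sigma> by (simp add: fact_numeral power_divide)
  finally show "(\<integral>\<^sup>+\<omega>. ennreal (Y \<omega> ^ 4) \<partial>M) = ennreal (3 * (\<sigma>\<^sup>2)\<^sup>2)" .
qed

context yeh_process
begin

abbreviation Z :: "real \<Rightarrow> 'w \<Rightarrow> real" where "Z \<equiv> centered lam X"

lemma scaled_increment_normal:
  assumes "a \<le> s" "s < t" "t \<le> b" "c \<noteq> 0"
  shows "distributed M lborel (\<lambda>\<omega>. c * (Z t \<omega> - Z s \<omega>)) (normal_density 0 (\<bar>c\<bar> * sqrt (\<rho> t - \<rho> s)))"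
proof -
  have "0 < sqrt (\<rho> t - \<rho> s)"
    using rho_strict_mono assms by simp
  from normal_density_affine[OF normal_increments[OF assms(1-3)] this assms(4), of "- c * (lam t - lam s)"]
  show ?thesis
    by (simp add: centered_def algebra_simps)
qed

text \<open>The integral of a step function is a sum of independent centered normal variables, hence
  centered normal of variance \<open>v\<close>.\<close>
lemma step_integral_moments:
  fixes c :: "nat \<Rightarrow> real"
  assumes p: "partition_of a b n t"
  defines "v \<equiv> \<Sum>i<n. (c i)\<^sup>2 * (\<rho> (t (Suc i)) - \<rho> (t i))"
  shows "step_integral Z n t c \<in> L2_space M" "(L2_norm M (step_integral Z n t c))\<^sup>2 = v"
    "(\<integral>\<^sup>+\<omega>. ennreal (step_integral Z n t c \<omega> ^ 4) \<partial>M) = ennreal (3 * v\<^sup>2)"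
proof -
  \<comment> \<open>a summand with coefficient zero is constant and has no density, so it is dropped\<close>
  define J where "J = {i. i < n \<and> c i \<noteq> 0}"
  have J: "finite J" "J \<subseteq> {..<n}"
    by (auto simp: J_def)
  define \<sigma> where "\<sigma> i = \<bar>c i\<bar> * sqrt (\<rho> (t (Suc i)) - \<rho> (t i))" for i
  let ?Y = "\<lambda>i \<omega>. c i * (Z (t (Suc i)) \<omega> - Z (t i) \<omega>)"
  have cell: "a \<le> t i" "t i < t (Suc i)" "t (Suc i) \<le> b" "0 < \<rho> (t (Suc i)) - \<rho> (t i)" if "i < n" for i
    using partition_in_interval[OF p, of i] partition_in_interval[OF p, of "Suc i"] p that
      rho_strict_mono[of "t i" "t (Suc i)"]
    by (auto simp: partition_of_def)
  have I_eq: "step_integral Z n t c = (\<lambda>\<omega>. \<Sum>i\<in>J. ?Y i \<omega>)"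
    unfolding step_integral_def using J by (intro ext sum.mono_neutral_right) (auto simp: J_def)
  have v_eq: "v = (\<Sum>i\<in>J. (\<sigma> i)\<^sup>2)"
  proof -
    have "v = (\<Sum>i<n. (\<sigma> i)\<^sup>2)"
      unfolding v_def \<sigma>_def using cell(4) by (intro sum.cong refl) (auto simp: power_mult_distrib less_imp_le)
    also have "\<dots> = (\<Sum>i\<in>J. (\<sigma> i)\<^sup>2)"
      using J by (intro sum.mono_neutral_right) (auto simp: J_def \<sigma>_def)
    finally show ?thesis .
  qed
  have "step_integral Z n t c \<in> L2_space M \<and> (L2_norm M (step_integral Z n t c))\<^sup>2 = v \<and>
    (\<integral>\<^sup>+\<omega>. ennreal (step_integral Z n t c \<omega> ^ 4) \<partial>M) = ennreal (3 * v\<^sup>2)"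
  proof (cases "J = {}")
    case True
    then show ?thesis
      by (simp add: I_eq v_eq L2_norm_zero L2_space_iff)
  next
    case False
    have "indep_vars (\<lambda>_. borel) (\<lambda>i \<omega>. X (t (Suc i)) \<omega> - X (t i) \<omega>) {..<n}"
      using p by (intro independent_increments) (auto simp: partition_of_def)
    then have "indep_vars (\<lambda>_. borel) (\<lambda>i \<omega>. c i * ((X (t (Suc i)) \<omega> - X (t i) \<omega>) - (lam (t (Suc i)) - lam (t i)))) {..<n}"
      by (rule indep_vars_compose2) measurable
    then have "indep_vars (\<lambda>_. borel) ?Y {..<n}"
      by (simp add: centered_def algebra_simps)
    then have indep: "indep_vars (\<lambda>_. borel) ?Y J"
      using J(2) by (rule indep_vars_subset)
    have \<sigma>: "0 < \<sigma> i" if "i \<in> J" for i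
      using that cell(4)[of i] by (auto simp: J_def \<sigma>_def)
    have v: "0 < v"
      unfolding v_eq using \<sigma> J False by (intro sum_pos) (auto simp: less_imp_neq[symmetric])
    have "distributed M lborel (\<lambda>\<omega>. \<Sum>i\<in>J. ?Y i \<omega>) (normal_density (\<Sum>i\<in>J. 0) (sqrt (\<Sum>i\<in>J. (\<sigma> i)\<^sup>2)))"
    proof (rule sum_indep_normal[OF J(1) False indep \<sigma>])
      fix i assume "i \<in> J"
      then show "distributed M lborel (?Y i) (normal_density 0 (\<sigma> i))"
        unfolding \<sigma>_def using cell[of i] by (intro scaled_increment_normal) (auto simp: J_def)
    qed
    then have "distributed M lborel (step_integral Z n t c) (normal_density 0 (sqrt v))"
      by (simp add: I_eq v_eq)
    from normal_second_fourth_moment[OF this] v show ?thesis by simp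
  qed
  then show "step_integral Z n t c \<in> L2_space M" "(L2_norm M (step_integral Z n t c))\<^sup>2 = v"
    "(\<integral>\<^sup>+\<omega>. ennreal (step_integral Z n t c \<omega> ^ 4) \<partial>M) = ennreal (3 * v\<^sup>2)"
    by auto
qed

lemma increment_square:
  assumes "s \<in> {a..b}" "t \<in> {a..b}"
  shows "(\<lambda>\<omega>. Z t \<omega> - Z s \<omega>) \<in> L2_space M"
    "(L2_norm M (\<lambda>\<omega>. Z t \<omega> - Z s \<omega>))\<^sup>2 = \<bar>\<rho> t - \<rho> s\<bar>"
proof -
  have less: "(\<lambda>\<omega>. Z t \<omega> - Z s \<omega>) \<in> L2_space M \<and> (L2_norm M (\<lambda>\<omega>. Z t \<omega> - Z s \<omega>))\<^sup>2 = \<bar>\<rho> t - \<rho> s\<bar>"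
    if "a \<le> s" "s < t" "t \<le> b" for s t
    using normal_second_fourth_moment[OF scaled_increment_normal[OF that, of 1]] rho_strict_mono[OF that]
    by simp
  consider "s < t" | "s = t" | "t < s" by linarith
  then have "(\<lambda>\<omega>. Z t \<omega> - Z s \<omega>) \<in> L2_space M \<and> (L2_norm M (\<lambda>\<omega>. Z t \<omega> - Z s \<omega>))\<^sup>2 = \<bar>\<rho> t - \<rho> s\<bar>"
  proof cases
    case 1
    then show ?thesis using less assms by simp
  next
    case 2
    then show ?thesis by (simp add: L2_norm_zero L2_space_iff)
  next
    case 3
    then show ?thesis
      using less[of t s] assms L2_space_cmult[of "\<lambda>\<omega>. Z s \<omega> - Z t \<omega>" M "-1"]
      by (simp add: L2_norm_minus_commute[of M "Z t"] abs_minus_commute)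
  qed
  then show "(\<lambda>\<omega>. Z t \<omega> - Z s \<omega>) \<in> L2_space M"
    "(L2_norm M (\<lambda>\<omega>. Z t \<omega> - Z s \<omega>))\<^sup>2 = \<bar>\<rho> t - \<rho> s\<bar>"
    by auto
qed

text \<open>Polarization writes the product of two increments as a combination of squares of increments,
  whose expectations are known. The variances therefore determine all covariances, whatever the
  relative position of the two intervals.\<close>
lemma increment_covariance:
  assumes st: "a \<le> s" "s \<le> t" "t \<le> b" and uv: "a \<le> u" "u \<le> v" "v \<le> b"
  shows "L2_inner M (\<lambda>\<omega>. Z t \<omega> - Z s \<omega>) (\<lambda>\<omega>. Z v \<omega> - Z u \<omega>)
    = L2_inner \<mu> (indicator {s..<t}) (indicator {u..<v})"
proof -
  have bounds: "s \<le> b" "a \<le> t" "u \<le> b" "a \<le> v"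
    using st uv by auto
  have mono: "\<rho> x \<le> \<rho> y" if "a \<le> x" "x \<le> y" "y \<le> b" for x y
    using that by (intro mono_onD[OF mono_rho]) auto
  let ?d = "\<lambda>x y \<omega>. Z x \<omega> - Z y \<omega>"
  have int: "integrable M (\<lambda>\<omega>. (?d x y \<omega>)\<^sup>2)" if "x \<in> {a..b}" "y \<in> {a..b}" for x y
    using increment_square(1)[of y x] that by (intro L2_space_square) auto
  have sq: "(\<integral>\<omega>. (?d x y \<omega>)\<^sup>2 \<partial>M) = \<bar>\<rho> x - \<rho> y\<bar>" if "x \<in> {a..b}" "y \<in> {a..b}" for x y
    using increment_square(2)[of y x] that by (simp add: L2_norm_square)
  have "L2_inner M (?d t s) (?d v u)
      = (\<integral>\<omega>. ((?d t u \<omega>)\<^sup>2 + (?d s v \<omega>)\<^sup>2 - (?d t v \<omega>)\<^sup>2 - (?d s u \<omega>)\<^sup>2) / 2 \<partial>M)"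
    unfolding L2_inner_def
    by (intro Bochner_Integration.integral_cong) (simp_all add: power2_eq_square field_simps)
  also have "\<dots> = (\<bar>\<rho> t - \<rho> u\<bar> + \<bar>\<rho> s - \<rho> v\<bar> - \<bar>\<rho> t - \<rho> v\<bar> - \<bar>\<rho> s - \<rho> u\<bar>) / 2"
    using st uv bounds by (simp add: int sq)
  also have "\<dots> = measure \<mu> ({s..<t} \<inter> {u..<v})"
  proof (cases "max s u \<le> min t v")
    case True
    have "measure \<mu> ({s..<t} \<inter> {u..<v}) = \<rho> (min t v) - \<rho> (max s u)"
      using True st uv by (simp add: measure_stieltjes_Ico)
    moreover have "\<rho> (min t v) = min (\<rho> t) (\<rho> v)" "\<rho> (max s u) = max (\<rho> s) (\<rho> u)"
      using mono[of t v] mono[of v t] mono[of s u] mono[of u s] st uv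
      by (auto simp: min_def max_def intro!: antisym)
    moreover have "\<rho> u \<le> \<rho> t" "\<rho> s \<le> \<rho> v"
      using True st uv by (auto intro!: mono)
    ultimately show ?thesis by (auto simp: min_def max_def abs_if)
  next
    case False
    then have empty: "{s..<t} \<inter> {u..<v} = {}" by auto
    from False have "t < u \<or> v < s" using st uv by auto
    then show ?thesis
    proof
      assume "t < u"
      then have "\<rho> s \<le> \<rho> t" "\<rho> t \<le> \<rho> u" "\<rho> u \<le> \<rho> v"
        using st uv by (auto intro!: mono)
      then show ?thesis unfolding empty by simp
    next
      assume "v < s"
      then have "\<rho> u \<le> \<rho> v" "\<rho> v \<le> \<rho> s" "\<rho> s \<le> \<rho> t"
        using st uv by (auto intro!: mono)
      then show ?thesis unfolding empty by simp
    qed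
  qed
  also have "\<dots> = L2_inner \<mu> (indicator {s..<t}) (indicator {u..<v})"
  proof -
    have prod: "(\<lambda>x. indicator {s..<t} x * indicator {u..<v} x :: real) = indicator ({s..<t} \<inter> {u..<v})"
      by (auto simp: fun_eq_iff indicator_def)
    have "({s..<t} \<inter> {u..<v}) \<inter> space \<mu> = {s..<t} \<inter> {u..<v}"
      using st by auto
    then show ?thesis
      unfolding L2_inner_def prod Bochner_Integration.integral_indicator by (rule arg_cong[OF sym])
  qed
  finally show ?thesis .
qed

lemma step_integral_inner:
  assumes p: "partition_of a b n t" and q: "partition_of a b m s"
  shows "L2_inner M (step_integral Z n t c) (step_integral Z m s d)
    = L2_inner \<mu> (step_function n t c) (step_function m s d)"
proof -
  have cell: "a \<le> t i" "t i \<le> t (Suc i)" "t (Suc i) \<le> b"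
    if "partition_of a b n t" "i < n" for n t i
    using partition_in_interval[OF that(1), of i] partition_in_interval[OF that(1), of "Suc i"] that
    by (auto simp: partition_of_def less_imp_le)
  have incr: "(\<lambda>\<omega>. Z (t (Suc i)) \<omega> - Z (t i) \<omega>) \<in> L2_space M" if "partition_of a b n t" "i < n" for n t i
    using cell[OF that] by (intro increment_square) auto
  have ind: "indicator {x..<y} \<in> L2_space \<mu>" for x y :: real
    by (intro L2_space_bounded[OF finite_measure_stieltjes, of _ 1] borel_measurable_stieltjes) auto
  have "L2_inner M (step_integral Z n t c) (step_integral Z m s d)
      = (\<Sum>i<n. \<Sum>j<m. c i * d j * L2_inner M (\<lambda>\<omega>. Z (t (Suc i)) \<omega> - Z (t i) \<omega>) (\<lambda>\<omega>. Z (s (Suc j)) \<omega> - Z (s j) \<omega>))"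
    unfolding step_integral_def
    by (rule L2_inner_combinations) (simp_all add: incr[OF p] incr[OF q])
  also have "\<dots> = (\<Sum>i<n. \<Sum>j<m. c i * d j * L2_inner \<mu> (indicator {t i..<t (Suc i)}) (indicator {s j..<s (Suc j)}))"
    using cell[OF p] cell[OF q] by (intro sum.cong refl) (simp add: increment_covariance)
  also have "\<dots> = L2_inner \<mu> (step_function n t c) (step_function m s d)"
    unfolding step_function_def by (rule L2_inner_combinations[symmetric]) (simp_all add: ind)
  finally show ?thesis .
qed

text \<open>The two partitions are unrelated: the inner products in the expansion of the square are compared
  cell by cell, so that the integral is seen to depend only on the function and not on the
  partition presenting it.\<close>
lemma step_integral_isometry:
  assumes p: "partition_of a b n t" and q: "partition_of a b m s"
  shows "L2_norm M (\<lambda>\<omega>. step_integral Z n t c \<omega> - step_integral Z m s d \<omega>)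
    = L2_norm \<mu> (\<lambda>x. step_function n t c x - step_function m s d x)"
proof -
  have "(L2_norm M (\<lambda>\<omega>. step_integral Z n t c \<omega> - step_integral Z m s d \<omega>))\<^sup>2
      = (L2_norm \<mu> (\<lambda>x. step_function n t c x - step_function m s d x))\<^sup>2"
    unfolding L2_norm_square_diff[OF step_integral_moments(1)[OF p] step_integral_moments(1)[OF q]]
      L2_norm_square_diff[OF step_function_L2 step_function_L2]
    by (simp add: L2_norm_square_inner step_integral_inner p q)
  then show ?thesis
    by (simp add: power2_eq_iff_nonneg L2_norm_nonneg)
qed

lemma step_integral_norm:
  assumes "partition_of a b n t"
  shows "L2_norm M (step_integral Z n t c) = L2_norm \<mu> (step_function n t c)"
  using step_integral_inner[OF assms assms, of c c] by (simp add: L2_norm_def)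

lemma step_integral_fourth_moment:
  assumes "partition_of a b n t"
  shows "(\<integral>\<^sup>+\<omega>. ennreal (step_integral Z n t c \<omega> ^ 4) \<partial>M) = ennreal (3 * ((L2_norm \<mu> (step_function n t c))\<^sup>2)\<^sup>2)"
  using step_integral_moments(2,3)[OF assms, of c] step_integral_norm[OF assms, of c] by simp

section \<open>The Wiener integral as an isometry\<close>

lemma partition_uniform: "partition_of a b (Suc N) (uniform_partition a b N)"
  using interval by (intro partition_of_uniform)

abbreviation uniform_integral :: "nat \<Rightarrow> (nat \<Rightarrow> real) \<Rightarrow> 'w \<Rightarrow> real" where
  "uniform_integral N \<equiv> step_integral Z (Suc N) (uniform_partition a b N)"

text \<open>The graph of the extended integral, described by step functions on the uniform partitions. Linear
  combinations, norms and moment bounds pass to the limit directly in this form.\<close>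
definition uniform_limit_pair :: "(real \<Rightarrow> real) \<Rightarrow> ('w \<Rightarrow> real) \<Rightarrow> bool" where
  "uniform_limit_pair f Y \<longleftrightarrow> (\<exists>c. L2_tendsto \<mu> (\<lambda>N. uniform_step a b N (c N)) f \<and>
     L2_tendsto M (\<lambda>N. uniform_integral N (c N)) Y)"

lemma uniform_limit_pair_linear:
  assumes "uniform_limit_pair f Y" "uniform_limit_pair g W"
  shows "uniform_limit_pair (\<lambda>x. u * f x + v * g x) (\<lambda>\<omega>. u * Y \<omega> + v * W \<omega>)"
proof -
  obtain c d where c: "L2_tendsto \<mu> (\<lambda>N. uniform_step a b N (c N)) f" "L2_tendsto M (\<lambda>N. uniform_integral N (c N)) Y"
    and d: "L2_tendsto \<mu> (\<lambda>N. uniform_step a b N (d N)) g" "L2_tendsto M (\<lambda>N. uniform_integral N (d N)) W"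
    using assms by (auto simp: uniform_limit_pair_def)
  have "L2_tendsto \<mu> (\<lambda>N. uniform_step a b N (\<lambda>i. u * c N i + v * d N i)) (\<lambda>x. u * f x + v * g x)"
    using L2_tendsto_add[OF L2_tendsto_cmult[OF c(1), of u] L2_tendsto_cmult[OF d(1), of v]]
    by (simp only: step_function_linear[abs_def])
  moreover have "L2_tendsto M (\<lambda>N. uniform_integral N (\<lambda>i. u * c N i + v * d N i)) (\<lambda>\<omega>. u * Y \<omega> + v * W \<omega>)"
    using L2_tendsto_add[OF L2_tendsto_cmult[OF c(2), of u] L2_tendsto_cmult[OF d(2), of v]]
    by (simp only: step_integral_linear[abs_def])
  ultimately show ?thesis unfolding uniform_limit_pair_def by (intro exI conjI)
qed

lemma uniform_limit_pair_sum:
  assumes "finite I" "\<And>i. i \<in> I \<Longrightarrow> uniform_limit_pair (f i) (Y i)"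
  shows "uniform_limit_pair (\<lambda>x. \<Sum>i\<in>I. u i * f i x) (\<lambda>\<omega>. \<Sum>i\<in>I. u i * Y i \<omega>)"
  using assms
proof (induction I rule: finite_induct)
  case empty
  show ?case
    unfolding uniform_limit_pair_def
    by (rule exI[of _ "\<lambda>N i. 0"])
      (simp add: step_function_def step_integral_def L2_tendsto_def L2_space_iff L2_norm_zero)
next
  case (insert i I)
  then show ?case
    using uniform_limit_pair_linear[of "f i" "Y i" "\<lambda>x. \<Sum>i\<in>I. u i * f i x" "\<lambda>\<omega>. \<Sum>i\<in>I. u i * Y i \<omega>" "u i" 1]
    by simp
qed

lemma uniform_limit_pair_norm:
  assumes "uniform_limit_pair f Y"
  shows "L2_norm M Y = L2_norm \<mu> f"
proof -
  obtain c where c: "L2_tendsto \<mu> (\<lambda>N. uniform_step a b N (c N)) f" "L2_tendsto M (\<lambda>N. uniform_integral N (c N)) Y"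
    using assms by (auto simp: uniform_limit_pair_def)
  have "(\<lambda>N. L2_norm \<mu> (uniform_step a b N (c N))) \<longlonglongrightarrow> L2_norm M Y"
    using L2_tendsto_norm[OF c(2)] by (simp add: step_integral_norm[OF partition_uniform])
  with L2_tendsto_norm[OF c(1)] show ?thesis
    by (rule LIMSEQ_unique[symmetric])
qed

text \<open>Convergence in mean square gives no control of fourth moments by itself; Fatou's lemma along an
  almost surely convergent subsequence does.\<close>
lemma uniform_limit_pair_fourth_moment:
  assumes "uniform_limit_pair f Y"
  shows "(\<integral>\<^sup>+\<omega>. ennreal (Y \<omega> ^ 4) \<partial>M) \<le> ennreal (3 * ((L2_norm \<mu> f)\<^sup>2)\<^sup>2)"
proof -
  obtain c where c: "L2_tendsto \<mu> (\<lambda>N. uniform_step a b N (c N)) f" "L2_tendsto M (\<lambda>N. uniform_integral N (c N)) Y"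
    using assms by (auto simp: uniform_limit_pair_def)
  obtain r where r: "strict_mono r" "AE \<omega> in M. (\<lambda>k. uniform_integral (r k) (c (r k)) \<omega>) \<longlonglongrightarrow> Y \<omega>"
    using L2_tendsto_AE_subseq[OF c(2)] by blast
  show ?thesis
  proof (rule nn_integral_limit_le)
    show "(\<lambda>\<omega>. uniform_integral (r k) (c (r k)) \<omega> ^ 4) \<in> borel_measurable M" for k
      using L2_space_measurable[OF step_integral_moments(1)[OF partition_uniform, of "r k" "c (r k)"]]
      by (rule borel_measurable_power)
    show "(\<integral>\<^sup>+\<omega>. ennreal (uniform_integral (r k) (c (r k)) \<omega> ^ 4) \<partial>M)
        \<le> ennreal (3 * ((L2_norm \<mu> (uniform_step a b (r k) (c (r k))))\<^sup>2)\<^sup>2)" for k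
      by (simp add: step_integral_fourth_moment[OF partition_uniform])
    show "(\<lambda>k. 3 * ((L2_norm \<mu> (uniform_step a b (r k) (c (r k))))\<^sup>2)\<^sup>2) \<longlonglongrightarrow> 3 * ((L2_norm \<mu> f)\<^sup>2)\<^sup>2"
      using LIMSEQ_subseq_LIMSEQ[OF L2_tendsto_norm[OF c(1)] r(1)]
      by (intro tendsto_intros) (simp add: comp_def)
    show "AE \<omega> in M. (\<lambda>k. uniform_integral (r k) (c (r k)) \<omega> ^ 4) \<longlonglongrightarrow> Y \<omega> ^ 4"
      using r(2) by eventually_elim (intro tendsto_intros)
  qed
qed

text \<open>The integrals along the uniform partitions form a Cauchy sequence because the step functions do.
  By the isometry, any other approximating sequence of step functions has integrals at vanishing
  distance from these, hence the same limit.\<close>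
lemma wiener_integral_exists:
  assumes f: "f \<in> L2_space \<mu>"
  shows "\<exists>Y. is_wiener_integral M a b \<rho> Z f Y"
proof -
  obtain c where c: "L2_tendsto \<mu> (\<lambda>N. uniform_step a b N (c N)) f"
    using approximable_obtain_sequence[OF uniform_steps_dense[OF f]] by blast
  let ?g = "\<lambda>N. uniform_step a b N (c N)" and ?I = "\<lambda>N. uniform_integral N (c N)"
  have lim: "(\<lambda>N. L2_norm \<mu> (\<lambda>x. ?g N x - f x)) \<longlonglongrightarrow> 0"
    using c by (simp add: L2_tendsto_def)
  have I: "?I N \<in> L2_space M" for N
    by (rule step_integral_moments(1)[OF partition_uniform])
  have "\<exists>Y. L2_tendsto M ?I Y"
  proof (rule L2_complete[OF I])
    fix e :: real assume e: "0 < e"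
    obtain N0 where N0: "L2_norm \<mu> (\<lambda>x. ?g N x - f x) < e / 2" if "N0 \<le> N" for N
      using order_tendstoD(2)[OF lim half_gt_zero[OF e]] by (auto simp: eventually_sequentially)
    have "L2_norm M (\<lambda>\<omega>. ?I m \<omega> - ?I n \<omega>) < e" if "N0 \<le> m" "N0 \<le> n" for m n
    proof -
      have "L2_norm M (\<lambda>\<omega>. ?I m \<omega> - ?I n \<omega>) = L2_norm \<mu> (\<lambda>x. ?g m x - ?g n x)"
        by (intro step_integral_isometry partition_uniform)
      also have "\<dots> \<le> L2_norm \<mu> (\<lambda>x. ?g m x - f x) + L2_norm \<mu> (\<lambda>x. f x - ?g n x)"
        using f by (intro L2_norm_triangle_diff step_function_L2)
      finally show ?thesis
        using N0[OF that(1)] N0[OF that(2)] by (simp add: L2_norm_minus_commute[of \<mu> f])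
    qed
    then show "\<exists>N. \<forall>m\<ge>N. \<forall>n\<ge>N. L2_norm M (\<lambda>\<omega>. ?I m \<omega> - ?I n \<omega>) < e" by blast
  qed
  then obtain Y where Y: "L2_tendsto M ?I Y" by blast
  have "is_wiener_integral M a b \<rho> Z f Y"
    unfolding is_wiener_integral_def
  proof (intro conjI allI impI)
    show YL: "Y \<in> L2_space M" using Y by (simp add: L2_tendsto_def)
    fix n t d assume p: "\<forall>k. partition_of a b (n k) (t k)"
      and h: "L2_tendsto \<mu> (\<lambda>k. step_function (n k) (t k) (d k)) f"
    let ?h = "\<lambda>k. step_function (n k) (t k) (d k)" and ?K = "\<lambda>k. step_integral Z (n k) (t k) (d k)"
    have K: "?K k \<in> L2_space M" for k
      using p by (intro step_integral_moments(1)) auto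
    have "(\<lambda>k. L2_norm M (\<lambda>\<omega>. ?K k \<omega> - Y \<omega>)) \<longlonglongrightarrow> 0"
    proof (rule Lim_null_comparison)
      show "\<forall>\<^sub>F k in sequentially. norm (L2_norm M (\<lambda>\<omega>. ?K k \<omega> - Y \<omega>))
          \<le> (L2_norm \<mu> (\<lambda>x. ?h k x - f x) + L2_norm \<mu> (\<lambda>x. ?g k x - f x)) + L2_norm M (\<lambda>\<omega>. ?I k \<omega> - Y \<omega>)"
      proof (intro always_eventually allI)
        fix k
        have "L2_norm M (\<lambda>\<omega>. ?K k \<omega> - Y \<omega>)
            \<le> L2_norm M (\<lambda>\<omega>. ?K k \<omega> - ?I k \<omega>) + L2_norm M (\<lambda>\<omega>. ?I k \<omega> - Y \<omega>)"
          by (intro L2_norm_triangle_diff K I YL)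
        also have "L2_norm M (\<lambda>\<omega>. ?K k \<omega> - ?I k \<omega>) = L2_norm \<mu> (\<lambda>x. ?h k x - ?g k x)"
          using p by (intro step_integral_isometry partition_uniform) auto
        also have "\<dots> \<le> L2_norm \<mu> (\<lambda>x. ?h k x - f x) + L2_norm \<mu> (\<lambda>x. f x - ?g k x)"
          using f by (intro L2_norm_triangle_diff step_function_L2)
        finally show "norm (L2_norm M (\<lambda>\<omega>. ?K k \<omega> - Y \<omega>))
          \<le> (L2_norm \<mu> (\<lambda>x. ?h k x - f x) + L2_norm \<mu> (\<lambda>x. ?g k x - f x)) + L2_norm M (\<lambda>\<omega>. ?I k \<omega> - Y \<omega>)"
          by (simp add: L2_norm_nonneg L2_norm_minus_commute[of \<mu> f])
      qed
      show "(\<lambda>k. (L2_norm \<mu> (\<lambda>x. ?h k x - f x) + L2_norm \<mu> (\<lambda>x. ?g k x - f x)) + L2_norm M (\<lambda>\<omega>. ?I k \<omega> - Y \<omega>)) \<longlonglongrightarrow> 0"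
        using h Y lim by (intro tendsto_add_zero) (simp_all add: L2_tendsto_def)
    qed
    then show "L2_tendsto M ?K Y"
      using K YL by (simp add: L2_tendsto_def)
  qed
  then show ?thesis by blast
qed

lemma wiener_integral_uniform_limit:
  assumes f: "f \<in> L2_space \<mu>"
  shows "uniform_limit_pair f (wiener_integral M a b \<rho> Z f)"
proof -
  obtain c where c: "L2_tendsto \<mu> (\<lambda>N. uniform_step a b N (c N)) f"
    using approximable_obtain_sequence[OF uniform_steps_dense[OF f]] by blast
  have "is_wiener_integral M a b \<rho> Z f (wiener_integral M a b \<rho> Z f)"
    unfolding wiener_integral_def by (rule someI_ex[OF wiener_integral_exists[OF f]])
  then have "L2_tendsto M (\<lambda>N. uniform_integral N (c N)) (wiener_integral M a b \<rho> Z f)"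
    using c partition_uniform unfolding is_wiener_integral_def
    by (auto dest: spec[of _ Suc] spec[of _ "uniform_partition a b"])
  with c show ?thesis by (auto simp: uniform_limit_pair_def)
qed

end

section \<open>A maximal inequality and almost sure convergence\<close>

text \<open>Convexity of the fourth power with weights \<open>1/6\<close> and \<open>5/6\<close>. The coefficient of \<open>y ^ 4\<close> has to be
  less than 2 for the bisection in the maximal inequality below to close.\<close>
lemma fourth_power_sum_le:
  fixes x y :: real
  shows "(x + y) ^ 4 \<le> 216 * x ^ 4 + 216 / 125 * y ^ 4"
proof -
  have "6 * x\<^sup>2 + 6 / 5 * y\<^sup>2 - (x + y)\<^sup>2 = (5 * x - y)\<^sup>2 / 5"
    by (simp add: power2_eq_square field_simps)
  then have "(x + y)\<^sup>2 \<le> 6 * x\<^sup>2 + 6 / 5 * y\<^sup>2"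
    using zero_le_power2[of "5 * x - y"] by linarith
  then have "((x + y)\<^sup>2)\<^sup>2 \<le> (6 * x\<^sup>2 + 6 / 5 * y\<^sup>2)\<^sup>2"
    by (intro power_mono) auto
  also have "\<dots> = 216 * (x\<^sup>2)\<^sup>2 + 216 / 125 * (y\<^sup>2)\<^sup>2 - 36 / 125 * (25 * x\<^sup>2 - y\<^sup>2)\<^sup>2"
    by (simp add: power2_sum power2_diff power_mult_distrib field_simps)
  also have "\<dots> \<le> 216 * (x\<^sup>2)\<^sup>2 + 216 / 125 * (y\<^sup>2)\<^sup>2"
    by simp
  finally show ?thesis by (simp flip: power_mult)
qed

lemma ennreal_combination:
  assumes "0 \<le> s" "0 \<le> t" "0 \<le> x" "0 \<le> y"
  shows "ennreal (s * x + t * y) = ennreal s * ennreal x + ennreal t * ennreal y"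
  using assms by (simp add: ennreal_mult)

text \<open>By induction on the length of the block. Let \<open>U\<close> be the total weight and let \<open>h\<close> be the first index
  at which half of it is reached. The weights before \<open>h - 1\<close> and from \<open>h\<close> on are at most \<open>U / 2\<close> each, so the
  oscillations over the two parts have bounds that sum to \<open>2 * K * (U / 2)\<^sup>2 = K * U\<^sup>2 / 2\<close>, where \<open>K\<close>
  is the constant sought. An index \<open>k \<ge> h\<close> needs in addition the single increment from \<open>i\<close> to \<open>h\<close>,
  which contributes \<open>C * U\<^sup>2\<close>. With the coefficients of \<open>fourth_power_sum_le\<close> the induction closes as soon as
  \<open>216 * C + 216 / 125 * K / 2 \<le> K\<close>, and \<open>K = 1600 * C\<close> suffices.\<close>
lemma maximal_fourth_moment:
  fixes S :: "nat \<Rightarrow> 'a \<Rightarrow> real" and u :: "nat \<Rightarrow> real"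
  assumes [measurable]: "\<And>k. S k \<in> borel_measurable M"
    and u: "\<And>k. 0 \<le> u k" and C: "0 \<le> C"
    and fourth: "\<And>i j. i \<le> j \<Longrightarrow> (\<integral>\<^sup>+x. ennreal ((S j x - S i x) ^ 4) \<partial>M) \<le> ennreal (C * (\<Sum>k=i..<j. u k)\<^sup>2)"
    and "i \<le> j"
  shows "(\<integral>\<^sup>+x. (SUP k\<in>{i..j}. ennreal ((S k x - S i x) ^ 4)) \<partial>M) \<le> ennreal (1600 * C * (\<Sum>k=i..<j. u k)\<^sup>2)"
  using \<open>i \<le> j\<close>
proof (induction "j - i" arbitrary: i j rule: less_induct)
  case less
  let ?D = "\<lambda>i j x. SUP k\<in>{i..j}. ennreal ((S k x - S i x) ^ 4)"
  define U where "U = (\<Sum>k=i..<j. u k)"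
  have U: "0 \<le> U"
    unfolding U_def by (intro sum_nonneg u)
  show ?case
  proof (cases "i = j")
    case True
    then show ?thesis by simp
  next
    case False
    define h where "h = (LEAST h. i < h \<and> U / 2 \<le> (\<Sum>k=i..<h. u k))"
    have "i < j \<and> U / 2 \<le> (\<Sum>k=i..<j. u k)"
      using False less.prems U by (simp add: U_def)
    then have h: "i < h" "U / 2 \<le> (\<Sum>k=i..<h. u k)" "h \<le> j"
      unfolding h_def by (auto intro: LeastI2 Least_le)
    then obtain g where g: "h = Suc g" "i \<le> g"
      by (cases h) auto
    have left: "(\<Sum>k=i..<g. u k) \<le> U / 2"
    proof (cases "g = i")
      case True
      then show ?thesis using U by simp
    next
      case False
      moreover have "\<not> (i < g \<and> U / 2 \<le> (\<Sum>k=i..<g. u k))"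
        using not_less_Least[of g "\<lambda>h. i < h \<and> U / 2 \<le> (\<Sum>k=i..<h. u k)"] g(1) by (simp add: h_def)
      ultimately show ?thesis using g by auto
    qed
    have split: "(\<Sum>k=i..<h. u k) + (\<Sum>k=h..<j. u k) = U"
      unfolding U_def using h by (intro sum.atLeastLessThan_concat) auto
    then have right: "(\<Sum>k=h..<j. u k) \<le> U / 2"
      using h by simp
    have first: "(\<Sum>k=i..<h. u k) \<le> U"
      using split sum_nonneg[of "{h..<j}" u] u by simp
    have pointwise: "?D i j x \<le> ennreal 216 * ennreal ((S h x - S i x) ^ 4)
        + ennreal (216 / 125) * (?D i g x + ?D h j x)" for x
    proof (rule SUP_least)
      fix k assume k: "k \<in> {i..j}"
      show "ennreal ((S k x - S i x) ^ 4) \<le> ennreal 216 * ennreal ((S h x - S i x) ^ 4)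
          + ennreal (216 / 125) * (?D i g x + ?D h j x)"
      proof (cases "k \<le> g")
        case True
        have "ennreal ((S k x - S i x) ^ 4) = 1 * ennreal ((S k x - S i x) ^ 4)"
          by simp
        also have "\<dots> \<le> ennreal (216 / 125) * (?D i g x + ?D h j x)"
          using True k by (intro mult_mono add_increasing2 SUP_upper) auto
        also have "\<dots> \<le> ennreal 216 * ennreal ((S h x - S i x) ^ 4)
            + ennreal (216 / 125) * (?D i g x + ?D h j x)"
          by simp
        finally show ?thesis .
      next
        case False
        have "(S k x - S i x) ^ 4 \<le> 216 * (S h x - S i x) ^ 4 + 216 / 125 * (S k x - S h x) ^ 4"
          using fourth_power_sum_le[of "S h x - S i x" "S k x - S h x"] by simp
        then have "ennreal ((S k x - S i x) ^ 4)
            \<le> ennreal (216 * (S h x - S i x) ^ 4 + 216 / 125 * (S k x - S h x) ^ 4)"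
          by (rule ennreal_leI)
        also have "\<dots> = ennreal 216 * ennreal ((S h x - S i x) ^ 4)
            + ennreal (216 / 125) * ennreal ((S k x - S h x) ^ 4)"
          by (rule ennreal_combination) auto
        also have "\<dots> \<le> ennreal 216 * ennreal ((S h x - S i x) ^ 4)
            + ennreal (216 / 125) * (?D i g x + ?D h j x)"
          using False k g by (intro add_left_mono mult_left_mono add_increasing SUP_upper) auto
        finally show ?thesis .
      qed
    qed
    have IH: "(\<integral>\<^sup>+x. ?D i g x \<partial>M) \<le> ennreal (1600 * C * (U / 2)\<^sup>2)" "(\<integral>\<^sup>+x. ?D h j x \<partial>M) \<le> ennreal (1600 * C * (U / 2)\<^sup>2)"
    proof -
      have "(\<integral>\<^sup>+x. ?D i g x \<partial>M) \<le> ennreal (1600 * C * (\<Sum>k=i..<g. u k)\<^sup>2)"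
        using g h by (intro less.hyps) auto
      also have "\<dots> \<le> ennreal (1600 * C * (U / 2)\<^sup>2)"
        using left C by (intro ennreal_leI mult_left_mono power_mono sum_nonneg u) auto
      finally show "(\<integral>\<^sup>+x. ?D i g x \<partial>M) \<le> ennreal (1600 * C * (U / 2)\<^sup>2)" .
      have "(\<integral>\<^sup>+x. ?D h j x \<partial>M) \<le> ennreal (1600 * C * (\<Sum>k=h..<j. u k)\<^sup>2)"
        using g h by (intro less.hyps) auto
      also have "\<dots> \<le> ennreal (1600 * C * (U / 2)\<^sup>2)"
        using right C by (intro ennreal_leI mult_left_mono power_mono sum_nonneg u) auto
      finally show "(\<integral>\<^sup>+x. ?D h j x \<partial>M) \<le> ennreal (1600 * C * (U / 2)\<^sup>2)" .
    qed
    have "(\<integral>\<^sup>+x. ennreal ((S h x - S i x) ^ 4) \<partial>M) \<le> ennreal (C * (\<Sum>k=i..<h. u k)\<^sup>2)"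
      using h by (intro fourth) simp
    also have "\<dots> \<le> ennreal (C * U\<^sup>2)"
      using first C by (intro ennreal_leI mult_left_mono power_mono sum_nonneg u) auto
    finally have jump: "(\<integral>\<^sup>+x. ennreal ((S h x - S i x) ^ 4) \<partial>M) \<le> ennreal (C * U\<^sup>2)" .
    have "(\<integral>\<^sup>+x. ?D i j x \<partial>M) \<le> (\<integral>\<^sup>+x. ennreal 216 * ennreal ((S h x - S i x) ^ 4)
        + ennreal (216 / 125) * (?D i g x + ?D h j x) \<partial>M)"
      by (intro nn_integral_mono pointwise)
    also have "\<dots> = ennreal 216 * (\<integral>\<^sup>+x. ennreal ((S h x - S i x) ^ 4) \<partial>M)
        + ennreal (216 / 125) * ((\<integral>\<^sup>+x. ?D i g x \<partial>M) + (\<integral>\<^sup>+x. ?D h j x \<partial>M))"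
      by (subst nn_integral_add, measurable, subst nn_integral_cmult, measurable,
          subst nn_integral_cmult, measurable, subst nn_integral_add, measurable)
    also have "\<dots> \<le> ennreal 216 * ennreal (C * U\<^sup>2)
        + ennreal (216 / 125) * (ennreal (1600 * C * (U / 2)\<^sup>2) + ennreal (1600 * C * (U / 2)\<^sup>2))"
      using jump IH by (intro add_mono mult_left_mono) auto
    also have "\<dots> = ennreal (216 * (C * U\<^sup>2) + 216 / 125 * (1600 * C * (U / 2)\<^sup>2 + 1600 * C * (U / 2)\<^sup>2))"
    proof -
      have nonneg: "0 \<le> C * U\<^sup>2" "0 \<le> 1600 * C * (U / 2)\<^sup>2"
        using C by auto
      show ?thesis
        unfolding ennreal_plus[OF nonneg(2,2), symmetric]
        by (rule ennreal_combination[symmetric]) (use nonneg in auto)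
    qed
    also have "\<dots> \<le> ennreal (1600 * C * U\<^sup>2)"
    proof (rule ennreal_leI)
      have "0 \<le> C * U\<^sup>2" using C by simp
      then show "216 * (C * U\<^sup>2) + 216 / 125 * (1600 * C * (U / 2)\<^sup>2 + 1600 * C * (U / 2)\<^sup>2) \<le> 1600 * C * U\<^sup>2"
        by (simp add: power_divide)
    qed
    finally show ?thesis unfolding U_def .
  qed
qed

text \<open>Fatou's lemma is applied to the oscillation of \<open>S\<close> after the index \<open>i\<close> plus the squared distance of
  \<open>S i\<close> from the limit \<open>Y\<close>. The expectation of this sum tends to zero, so almost surely it is small
  for some \<open>i\<close>, and from that index on \<open>S\<close> stays close to \<open>Y\<close>.\<close>
lemma AE_convergent_of_fourth_moments:
  fixes S :: "nat \<Rightarrow> 'a \<Rightarrow> real" and u :: "nat \<Rightarrow> real"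
  assumes lim: "L2_tendsto M S Y"
    and u: "\<And>k. 0 \<le> u k" "summable u" and C: "0 \<le> C"
    and fourth: "\<And>i j. i \<le> j \<Longrightarrow> (\<integral>\<^sup>+x. ennreal ((S j x - S i x) ^ 4) \<partial>M) \<le> ennreal (C * (\<Sum>k=i..<j. u k)\<^sup>2)"
  shows "AE x in M. (\<lambda>k. S k x) \<longlonglongrightarrow> Y x"
proof -
  have [measurable]: "S k \<in> borel_measurable M" "Y \<in> borel_measurable M" for k
    using lim by (auto simp: L2_tendsto_def L2_space_iff)
  define T where "T i x = (SUP k\<in>{i..}. ennreal ((S k x - S i x) ^ 4))" for i x
  define G where "G i x = T i x + ennreal ((S i x - Y x)\<^sup>2)" for i x
  have [measurable]: "T i \<in> borel_measurable M" for i
    unfolding T_def by measurable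
  have [measurable]: "G i \<in> borel_measurable M" for i
    unfolding G_def by measurable
  define B where "B i = 1600 * C * (\<Sum>k. u (k + i))\<^sup>2 + (L2_norm M (\<lambda>x. S i x - Y x))\<^sup>2" for i
  have T_int: "(\<integral>\<^sup>+x. T i x \<partial>M) \<le> ennreal (1600 * C * (\<Sum>k. u (k + i))\<^sup>2)" for i
  proof -
    let ?D = "\<lambda>j x. SUP k\<in>{i..i + j}. ennreal ((S k x - S i x) ^ 4)"
    have "T i x = (SUP j. ?D j x)" for x
    proof (rule antisym)
      show "T i x \<le> (SUP j. ?D j x)"
        unfolding T_def
      proof (rule SUP_least)
        fix k assume "k \<in> {i..}"
        then have "ennreal ((S k x - S i x) ^ 4) \<le> ?D (k - i) x"
          by (intro SUP_upper) auto
        also have "\<dots> \<le> (SUP j. ?D j x)"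
          by (rule SUP_upper) simp
        finally show "ennreal ((S k x - S i x) ^ 4) \<le> (SUP j. ?D j x)" .
      qed
      show "(SUP j. ?D j x) \<le> T i x"
        unfolding T_def by (intro SUP_least SUP_upper) auto
    qed
    then have "(\<integral>\<^sup>+x. T i x \<partial>M) = (\<integral>\<^sup>+x. (SUP j. ?D j x) \<partial>M)"
      by simp
    also have "\<dots> = (SUP j. \<integral>\<^sup>+x. ?D j x \<partial>M)"
    proof (rule nn_integral_monotone_convergence_SUP)
      show "incseq ?D"
        by (auto simp: incseq_def le_fun_def intro!: SUP_subset_mono)
    qed measurable
    also have "\<dots> \<le> ennreal (1600 * C * (\<Sum>k. u (k + i))\<^sup>2)"
    proof (rule SUP_least)
      fix j
      have "(\<integral>\<^sup>+x. ?D j x \<partial>M) \<le> ennreal (1600 * C * (\<Sum>k=i..<i + j. u k)\<^sup>2)"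
        by (rule maximal_fourth_moment[OF _ u(1) C fourth]) auto
      also have "(\<Sum>k=i..<i + j. u k) = (\<Sum>k<j. u (k + i))"
        using sum.shift_bounds_nat_ivl[of u 0 i j] by (simp add: atLeast0LessThan add.commute)
      also have "ennreal (1600 * C * (\<Sum>k<j. u (k + i))\<^sup>2) \<le> ennreal (1600 * C * (\<Sum>k. u (k + i))\<^sup>2)"
        using C u by (intro ennreal_leI mult_left_mono power_mono sum_le_suminf sum_nonneg)
          (auto simp: summable_iff_shift)
      finally show "(\<integral>\<^sup>+x. ?D j x \<partial>M) \<le> ennreal (1600 * C * (\<Sum>k. u (k + i))\<^sup>2)" .
    qed
    finally show ?thesis .
  qed
  have G_int: "(\<integral>\<^sup>+x. G i x \<partial>M) \<le> ennreal (B i)" for i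
  proof -
    have "(\<integral>\<^sup>+x. G i x \<partial>M) = (\<integral>\<^sup>+x. T i x \<partial>M) + ennreal ((L2_norm M (\<lambda>x. S i x - Y x))\<^sup>2)"
      unfolding G_def using lim
      by (subst nn_integral_add) (auto simp: nn_integral_square_L2 L2_space_diff L2_tendsto_def)
    also have "\<dots> \<le> ennreal (1600 * C * (\<Sum>k. u (k + i))\<^sup>2) + ennreal ((L2_norm M (\<lambda>x. S i x - Y x))\<^sup>2)"
      using T_int by (intro add_right_mono)
    also have "\<dots> = ennreal (B i)"
      unfolding B_def using C by (subst ennreal_plus) auto
    finally show ?thesis .
  qed
  have "B \<longlonglongrightarrow> 1600 * C * 0\<^sup>2 + 0\<^sup>2"
    unfolding B_def using lim suminf_exist_split2[OF u(2)]
    by (intro tendsto_intros) (simp_all add: L2_tendsto_def)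
  then have "(\<lambda>i. ennreal (B i)) \<longlonglongrightarrow> ennreal 0"
    by (intro tendsto_ennrealI) simp
  then have "liminf (\<lambda>i. ennreal (B i)) = 0"
    using lim_imp_Liminf[OF trivial_limit_sequentially] by fastforce
  have "(\<integral>\<^sup>+x. liminf (\<lambda>i. G i x) \<partial>M) \<le> liminf (\<lambda>i. \<integral>\<^sup>+x. G i x \<partial>M)"
    by (intro nn_integral_liminf) measurable
  also have "\<dots> \<le> liminf (\<lambda>i. ennreal (B i))"
    by (intro Liminf_mono always_eventually allI G_int)
  also have "\<dots> = 0" by fact
  finally have "(\<integral>\<^sup>+x. liminf (\<lambda>i. G i x) \<partial>M) = 0" by simp
  then have "AE x in M. liminf (\<lambda>i. G i x) = 0"
    by (subst (asm) nn_integral_0_iff_AE) measurable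
  then show ?thesis
  proof (rule eventually_mono)
    fix x assume zero: "liminf (\<lambda>i. G i x) = 0"
    show "(\<lambda>k. S k x) \<longlonglongrightarrow> Y x"
    proof (rule LIMSEQ_I)
      fix e :: real assume e: "0 < e"
      define d where "d = min ((e / 2) ^ 4) ((e / 2)\<^sup>2)"
      have d: "0 < d" using e by (simp add: d_def)
      have "\<exists>i. G i x < ennreal d"
      proof (rule ccontr)
        assume "\<not> ?thesis"
        then have "ennreal d \<le> liminf (\<lambda>i. G i x)"
          by (intro Liminf_bounded always_eventually) (auto simp: not_less)
        with zero d show False by simp
      qed
      then obtain i where i: "G i x < ennreal d" by blast
      have "norm (S k x - Y x) < e" if "i \<le> k" for k
      proof -
        have "ennreal ((S k x - S i x) ^ 4) \<le> T i x"
          unfolding T_def using that by (intro SUP_upper) simp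
        also have "\<dots> \<le> G i x" by (simp add: G_def)
        finally have "ennreal ((S k x - S i x) ^ 4) < ennreal d"
          using i by (rule le_less_trans)
        then have "\<bar>S k x - S i x\<bar> ^ 4 < (e / 2) ^ 4"
          by (simp add: d_def ennreal_less_iff power_even_abs)
        then have 1: "\<bar>S k x - S i x\<bar> < e / 2"
          by (rule power_less_imp_less_base) (use e in simp)
        have "ennreal ((S i x - Y x)\<^sup>2) \<le> G i x" by (simp add: G_def)
        then have "ennreal ((S i x - Y x)\<^sup>2) < ennreal d"
          using i by (rule le_less_trans)
        then have "\<bar>S i x - Y x\<bar>\<^sup>2 < (e / 2)\<^sup>2"
          by (simp add: d_def ennreal_less_iff)
        then have 2: "\<bar>S i x - Y x\<bar> < e / 2"
          by (rule power_less_imp_less_base) (use e in simp)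
        from 1 2 show ?thesis unfolding real_norm_def by linarith
      qed
      then show "\<exists>i. \<forall>k\<ge>i. norm (S k x - Y x) < e" by blast
    qed
  qed
qed

section \<open>The random series expansion\<close>

theorem theorem4p1:
  fixes M :: "'w measure" and a b :: real and lam \<rho> :: "real \<Rightarrow> real"
    and X :: "real \<Rightarrow> 'w \<Rightarrow> real" and \<phi> :: "nat \<Rightarrow> real \<Rightarrow> real" and f :: "real \<Rightarrow> real"
  assumes "yeh_process M a b lam \<rho> X"
    and "L2_orthonormal_basis (stieltjes_on a b \<rho>) \<phi>"
    and "f \<in> L2_space (stieltjes_on a b \<rho>)"
  shows "L2_tendsto M
           (\<lambda>N \<omega>. \<Sum>n<N. L2_inner (stieltjes_on a b \<rho>) f (\<phi> n) *
              wiener_integral M a b \<rho> (centered lam X) (\<phi> n) \<omega>)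
           (wiener_integral M a b \<rho> (centered lam X) f) \<and>
         (AE \<omega> in M.
           (\<lambda>n. L2_inner (stieltjes_on a b \<rho>) f (\<phi> n) *
              wiener_integral M a b \<rho> (centered lam X) (\<phi> n) \<omega>)
           sums wiener_integral M a b \<rho> (centered lam X) f \<omega>)"
proof -
  interpret yeh_process M a b lam \<rho> X by fact
  let ?W = "wiener_integral M a b \<rho> Z" and ?c = "\<lambda>n. L2_inner \<mu> f (\<phi> n)"
  let ?S = "\<lambda>N \<omega>. \<Sum>n<N. ?c n * ?W (\<phi> n) \<omega>"
  have \<phi>: "\<And>n. \<phi> n \<in> L2_space \<mu>" "\<And>m n. L2_inner \<mu> (\<phi> m) (\<phi> n) = (if m = n then 1 else 0)"
    using assms(2) by (auto simp: L2_orthonormal_basis_def)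
  note expansion = orthonormal_basis_expansion[OF assms(2,3)]
  have W_f: "uniform_limit_pair f (?W f)"
    by (rule wiener_integral_uniform_limit[OF assms(3)])
  have W_sum: "uniform_limit_pair (\<lambda>x. \<Sum>n\<in>I. ?c n * \<phi> n x) (\<lambda>\<omega>. \<Sum>n\<in>I. ?c n * ?W (\<phi> n) \<omega>)" if "finite I" for I
    using that by (intro uniform_limit_pair_sum wiener_integral_uniform_limit \<phi>)
  have mem: "Y \<in> L2_space M" if "uniform_limit_pair g Y" for g Y
    using that by (auto simp: uniform_limit_pair_def L2_tendsto_def)
  have L2: "L2_tendsto M ?S (?W f)"
    unfolding L2_tendsto_def
  proof (intro conjI allI)
    show "?S N \<in> L2_space M" for N
      by (rule mem[OF W_sum]) simp
    show "?W f \<in> L2_space M"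
      by (rule mem[OF W_f])
    \<comment> \<open>the isometry, applied to the remainder of the Fourier expansion\<close>
    have "L2_norm M (\<lambda>\<omega>. ?S N \<omega> - ?W f \<omega>) = L2_norm \<mu> (\<lambda>x. (\<Sum>n<N. ?c n * \<phi> n x) - f x)" for N
      using uniform_limit_pair_norm[OF uniform_limit_pair_linear[OF W_sum[of "{..<N}"] W_f, of 1 "-1"]]
      by simp
    then show "(\<lambda>N. L2_norm M (\<lambda>\<omega>. ?S N \<omega> - ?W f \<omega>)) \<longlonglongrightarrow> 0"
      using expansion(1) by (simp add: L2_tendsto_def)
  qed
  moreover have "AE \<omega> in M. (\<lambda>N. ?S N \<omega>) \<longlonglongrightarrow> ?W f \<omega>"
  proof (rule AE_convergent_of_fourth_moments[OF L2, where u = "\<lambda>n. (?c n)\<^sup>2" and C = 3])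
    fix i j :: nat assume "i \<le> j"
    then have block: "?S j \<omega> - ?S i \<omega> = (\<Sum>n=i..<j. ?c n * ?W (\<phi> n) \<omega>)" for \<omega>
      using sum_diff_nat_ivl[of 0 i j "\<lambda>n. ?c n * ?W (\<phi> n) \<omega>"] by (simp add: atLeast0LessThan)
    show "(\<integral>\<^sup>+\<omega>. ennreal ((?S j \<omega> - ?S i \<omega>) ^ 4) \<partial>M) \<le> ennreal (3 * (\<Sum>n=i..<j. (?c n)\<^sup>2)\<^sup>2)"
      using uniform_limit_pair_fourth_moment[OF W_sum[of "{i..<j}"]]
      by (simp only: block orthonormal_norm_square_sum[OF \<phi>] finite_atLeastLessThan)
  qed (use expansion(2) in auto)
  ultimately show ?thesis
    by (simp add: sums_def)
qed

end
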